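(* Let $p, q,$ and $r$ be non-zero integers such that $p$ and $q$ are relatively prime, $|p|\geq q\geq 1$, and $r\geq 2$. Let $D$ be the standard diagram of the torus link $T(pr,qr)$. Suppose that $T(pr,qr)$ is $\mathbb{Z}$-colorable, or, equivalently, $pr$ or $qr$ is even. Then $mincol_{\mathbb{Z}}(D)=4$ if $r$ is even, and $mincol_{\mathbb{Z}}(D)=5$ if $r$ is odd.
   Context: A $\mathbb{Z}$-coloring of a link diagram $D$ is a map $\gamma:\{\text{arcs of } D\}\to\mathbb{Z}$ such that $2\gamma(a)=\gamma(b)+\gamma(c)$ at each crossing of $D$ with over arc $a$ and under arcs $b$ and $c$. It is non-trivial if it takes at least two distinct values (colors). A link is $\mathbb{Z}$-colorable if it has a diagram admitting a non-trivial $\mathbb{Z}$-coloring. For a diagram $D$ of a $\mathbb{Z}$-colorable link, $mincol_{\mathbb{Z}}(D)$ is the minimal number of distinct colors used by a non-trivial $\mathbb{Z}$-coloring of $D$. The torus link $T(a,b)$ is the link on the standardly embedded torus in 3-space running $a$ times meridionally and $b$ times longitudinally. For $a,b\geq 1$, let $B(a,b)$ be the braid diagram on $b$ horizontal strands (positions numbered $1,\dots,b$ from top to bottom) obtained by concatenating, from left to right, $a$ copies of the elementary braid diagram in which the strand in position $1$ passes over all the other $b-1$ strands to position $b$, while each other strand moves up by one position without the other strands crossing each other. (Thus, in a $\mathbb{Z}$-coloring, one elementary braid changes the colors $(c_1,\dots,c_b)$ of its left ends to $(2c_1-c_2,\dots,2c_1-c_b,c_1)$ at its right ends.) For $a\leq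 -1$, $B(a,b)$ is the diagram of the inverse braid, i.e. the reflection of $B(|a|,b)$ in a vertical line. The standard diagram of $T(a,b)$ is the closure of $B(a,b)$.
   Formalization: The equivalence of Z-colorability with "pr or qr is even" is stated only for r ≥ 3, since it fails for r = 2 (the Hopf link T(2,2) is not Z-colorable); the values of mincol are stated for every r ≥ 2 under Z-colorability. *)

theory Defs
  imports Main
begin

text \<open>
  A link diagram in general position is cut by vertical lines into slices, read from left to
  right.  Each slice contains one elementary tile and otherwise only strands running from left to
  right.  The strands met by a vertical line are numbered 0, 1, 2, ... from top to bottom.  A slice
  \<open>(t, i)\<close> has its tile on the strands starting at position \<open>i\<close>:
  \<open>Cup\<close> is an arc open to the right, \<open>Cap\<close> is an arc open to the left; at \<open>OverDown\<close> the over strand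
  runs from \<open>i\<close> on the left to \<open>i + 1\<close> on the right, at \<open>OverUp\<close> from \<open>i + 1\<close> on the left to \<open>i\<close> on
  the right, and the other strand passes under it.
\<close>

datatype tile = Cup | Cap | OverDown | OverUp

type_synonym slice = "tile \<times> nat"
type_synonym diagram = "slice list"

fun ins :: "tile \<Rightarrow> nat" where
  "ins Cup = 0" | "ins Cap = 2" | "ins OverDown = 2" | "ins OverUp = 2"

fun outs :: "tile \<Rightarrow> nat" where
  "outs Cup = 2" | "outs Cap = 0" | "outs OverDown = 2" | "outs OverUp = 2"

text \<open>Number of strands at the right end of \<open>D\<close>, with no strand at the left end.\<close>

definition width :: "diagram \<Rightarrow> nat" where
  "width D = foldl (\<lambda>w (t, i). w - ins t + outs t) 0 D"

definition link_diagram :: "diagram \<Rightarrow> bool" where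
  "link_diagram D \<longleftrightarrow>
     (\<forall>k < length D. snd (D ! k) + ins (fst (D ! k)) \<le> width (take k D)) \<and> width D = 0"


subsection \<open>Arcs and crossings\<close>

text \<open>The point \<open>(k, j)\<close> is where strand \<open>j\<close> meets the vertical line to the left of slice \<open>k\<close>.\<close>

type_synonym point = "nat \<times> nat"

definition points :: "diagram \<Rightarrow> point set" where
  "points D = {(k, j). k \<le> length D \<and> j < width (take k D)}"

text \<open>Two points are joined if some slice connects them without an undercrossing in between.\<close>

inductive joined :: "diagram \<Rightarrow> point \<Rightarrow> point \<Rightarrow> bool" for D where
  above: "k < length D \<Longrightarrow> D ! k = (t, i) \<Longrightarrow> j < i \<Longrightarrow> joined D (k, j) (Suc k, j)"
| below: "k < length D \<Longrightarrow> D ! k = (t, i) \<Longrightarrow> i + ins t + j < width (take k D) \<Longrightarrow>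
    joined D (k, i + ins t + j) (Suc k, i + outs t + j)"
| cup: "k < length D \<Longrightarrow> D ! k = (Cup, i) \<Longrightarrow> joined D (Suc k, i) (Suc k, i + 1)"
| cap: "k < length D \<Longrightarrow> D ! k = (Cap, i) \<Longrightarrow> joined D (k, i) (k, i + 1)"
| over_down: "k < length D \<Longrightarrow> D ! k = (OverDown, i) \<Longrightarrow> joined D (k, i) (Suc k, i + 1)"
| over_up: "k < length D \<Longrightarrow> D ! k = (OverUp, i) \<Longrightarrow> joined D (k, i + 1) (Suc k, i)"

definition same_arc :: "diagram \<Rightarrow> point rel" where
  "same_arc D = {(x, y). x \<in> points D \<and> y \<in> points D \<and> equivclp (joined D) x y}"

definition arcs :: "diagram \<Rightarrow> point set set" where
  "arcs D = points D // same_arc D"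

definition arc_of :: "diagram \<Rightarrow> point \<Rightarrow> point set" where
  "arc_of D x = same_arc D `` {x}"

text \<open>A crossing is recorded as the triple of its over arc and its two under arcs.\<close>

definition crossings :: "diagram \<Rightarrow> (point set \<times> point set \<times> point set) set" where
  "crossings D =
     {(arc_of D (k, i), arc_of D (k, i + 1), arc_of D (Suc k, i)) | k i.
        k < length D \<and> D ! k = (OverDown, i)} \<union>
     {(arc_of D (k, i + 1), arc_of D (k, i), arc_of D (Suc k, i + 1)) | k i.
        k < length D \<and> D ! k = (OverUp, i)}"


subsection \<open>Colorings\<close>

text \<open>Only the values of \<open>\<gamma>\<close> on \<open>arcs D\<close> matter.\<close>

definition Z_coloring :: "diagram \<Rightarrow> (point set \<Rightarrow> int) \<Rightarrow> bool" where
  "Z_coloring D \<gamma> \<longleftrightarrow> (\<forall>(a, b, c) \<in> crossings D. 2 * \<gamma> a = \<gamma> b + \<gamma> c)"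

definition nontrivial_Z_coloring :: "diagram \<Rightarrow> (point set \<Rightarrow> int) \<Rightarrow> bool" where
  "nontrivial_Z_coloring D \<gamma> \<longleftrightarrow>
     Z_coloring D \<gamma> \<and> (\<exists>a \<in> arcs D. \<exists>b \<in> arcs D. \<gamma> a \<noteq> \<gamma> b)"

text \<open>Meaningful only for diagrams that admit a nontrivial coloring; otherwise the value is
  unspecified.\<close>

definition mincol_Z :: "diagram \<Rightarrow> nat" where
  "mincol_Z D = (LEAST n. \<exists>\<gamma>. nontrivial_Z_coloring D \<gamma> \<and> card (\<gamma> ` arcs D) = n)"


subsection \<open>Links\<close>

text \<open>
  A link is given by the class of its diagrams under planar isotopy and Reidemeister moves.
  For sliced diagrams these are generated by the following local moves, as in the presentation of
  the category of unoriented tangles by generators and relations (Freyd--Yetter, Turaev).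
  Planar isotopy is generated by \<open>exchange\<close> (tiles without a common strand can be passed in either
  order), \<open>zigzag\<close> (a fold in a strand is straightened) and \<open>turn\<close> (a crossing is moved around a
  cup or cap).  The remaining variants of the three Reidemeister moves follow from those listed.
\<close>

inductive local_move :: "diagram \<Rightarrow> diagram \<Rightarrow> bool" where
  exchange: "local_move [(s, i), (t, i + outs s + j)] [(t, i + ins s + j), (s, i)]"
| zigzag1: "local_move [(Cup, i), (Cap, i + 1)] []"
| zigzag2: "local_move [(Cup, i + 1), (Cap, i)] []"
| turn1: "local_move [(OverDown, i), (Cap, i + 1)] [(OverUp, i + 1), (Cap, i)]"
| turn2: "local_move [(OverUp, i), (Cap, i + 1)] [(OverDown, i + 1), (Cap, i)]"
| turn3: "local_move [(Cup, i + 1), (OverDown, i)] [(Cup, i), (OverUp, i + 1)]"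
| turn4: "local_move [(Cup, i + 1), (OverUp, i)] [(Cup, i), (OverDown, i + 1)]"
| R1a: "local_move [(OverDown, i), (Cap, i)] [(Cap, i)]"
| R1b: "local_move [(OverUp, i), (Cap, i)] [(Cap, i)]"
| R1c: "local_move [(Cup, i), (OverDown, i)] [(Cup, i)]"
| R1d: "local_move [(Cup, i), (OverUp, i)] [(Cup, i)]"
| R2a: "local_move [(OverDown, i), (OverUp, i)] []"
| R2b: "local_move [(OverUp, i), (OverDown, i)] []"
| R3: "local_move [(OverDown, i), (OverDown, i + 1), (OverDown, i)]
         [(OverDown, i + 1), (OverDown, i), (OverDown, i + 1)]"

definition diagram_move :: "diagram \<Rightarrow> diagram \<Rightarrow> bool" where
  "diagram_move D D' \<longleftrightarrow> link_diagram D \<and> link_diagram D' \<and>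
     (\<exists>A B l r. local_move l r \<and> D = A @ l @ B \<and> D' = A @ r @ B)"

type_synonym link = "diagram set"

text \<open>The set of all diagrams of the link represented by \<open>D\<close>.\<close>

definition link_of :: "diagram \<Rightarrow> link" where
  "link_of D = {D'. equivclp diagram_move D D'}"

definition Z_colorable :: "link \<Rightarrow> bool" where
  "Z_colorable L \<longleftrightarrow> (\<exists>D \<in> L. \<exists>\<gamma>. nontrivial_Z_coloring D \<gamma>)"


subsection \<open>Torus links\<close>

text \<open>The strand in position 0 passes over all others to position \<open>b - 1\<close>.\<close>

definition elementary_braid :: "nat \<Rightarrow> diagram" where
  "elementary_braid b = map (Pair OverDown) [0..<b - 1]"

fun flip_tile :: "tile \<Rightarrow> tile" where
  "flip_tile Cup = Cap" | "flip_tile Cap = Cup"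
| "flip_tile OverDown = OverUp" | "flip_tile OverUp = OverDown"

text \<open>Reflection in a vertical line.\<close>

definition reflect :: "diagram \<Rightarrow> diagram" where
  "reflect D = rev (map (\<lambda>(t, i). (flip_tile t, i)) D)"

definition torus_braid :: "int \<Rightarrow> nat \<Rightarrow> diagram" where
  "torus_braid a b =
     (let w = concat (replicate (nat \<bar>a\<bar>) (elementary_braid b))
      in if a < 0 then reflect w else w)"

text \<open>
  The closure of a braid word \<open>w\<close> on \<open>b\<close> strands.  After the nested cups there are \<open>2 * b\<close> strands;
  strand \<open>j < b\<close> enters the braid, and \<open>2 * b - 1 - j\<close> is the strand that leads back below the braid
  from the right end to the left end in position \<open>j\<close>.
\<close>

definition braid_closure :: "nat \<Rightarrow> diagram \<Rightarrow> diagram" where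
  "braid_closure b w = map (Pair Cup) [0..<b] @ w @ map (Pair Cap) (rev [0..<b])"

definition standard_diagram :: "int \<Rightarrow> nat \<Rightarrow> diagram" where
  "standard_diagram a b = braid_closure b (torus_braid a b)"

definition torus_link :: "int \<Rightarrow> nat \<Rightarrow> link" where
  "torus_link a b = link_of (standard_diagram a b)"

end

theory Submission
  imports Defs
begin

text \<open>
  Reading a diagram from left to right, a coloring is a sequence of lists of integers, the colors of
  the strands met by successive vertical lines; each tile relates two consecutive lists. The lists
  to the left and to the right of a local move determine all colors in between, and they stay
  admissible when one side of the move is replaced by the other. Constant lists at both sides
  force a constant coloring in between, so each move preserves the existence of a nontrivial
  coloring (\<open>diagram_move_run\<close>), and colorability of a torus link can be tested on its standard
  diagram.

  A coloring of the standard diagram of \<open>T(a, b)\<close> is a list \<open>c\<^sub>0, \<dots>, c\<^sub>b\<^sub>-\<^sub>1\<close> fixed by the \<open>a\<close>-th power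
  of the elementary braid; a reflected braid runs through the same lists backwards, so the sign of
  \<open>a\<close> does not matter. One elementary braid is a cyclic shift followed by the point reflection at
  the first color. Hence, for \<open>c\<close> extended with period \<open>b\<close>, the \<open>k\<close>-th power shifts by \<open>k\<close> and
  applies the product \<open>g\<^sub>k\<close> of the reflections at \<open>c\<^sub>0, \<dots>, c\<^sub>k\<^sub>-\<^sub>1\<close>, that is
  \<open>g\<^sub>k(x) = 2 s\<^sub>k + (-1)\<^sup>k x\<close> with the alternating sum \<open>s\<^sub>k = c\<^sub>0 - c\<^sub>1 + \<dots>\<close> of \<open>k\<close> terms. The
  colors used are all the numbers \<open>g\<^sub>k(c\<^sub>j)\<close>
  (\<open>twists_transport\<close>, \<open>run_standard_diagram_colors\<close>).

  Lower bounds. If \<open>c\<^sub>k \<noteq> c\<^sub>k\<^sub>+\<^sub>1\<close>, then \<open>g\<^sub>k\<^sub>+\<^sub>2\<close> is \<open>g\<^sub>k\<close> followed by the translation by \<open>2d\<close> where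
  \<open>d = g\<^sub>k(c\<^sub>k) - g\<^sub>k(c\<^sub>k\<^sub>+\<^sub>1)\<close>; so the colors contain a progression of four terms with difference \<open>d\<close>.
  If there are no other colors, then all \<open>c\<^sub>j\<close> lie in \<open>{c\<^sub>k, c\<^sub>k\<^sub>+\<^sub>1}\<close>, since both \<open>g\<^sub>k(c\<^sub>j)\<close> and
  \<open>g\<^sub>k(c\<^sub>j) + 2d\<close> are terms of the progression. When \<open>a\<close> or \<open>b\<close> is odd, this is refuted by a
  parity argument on alternating sums. If \<open>r\<close> is odd, one of \<open>a = pr\<close> and \<open>b = qr\<close> is odd because
  \<open>p\<close> and \<open>q\<close> are coprime.

  Existence. If \<open>a\<close> and \<open>b\<close> are odd, or if \<open>r = 2\<close>, the fixed lists are constant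
  (\<open>constant_odd_odd\<close>, \<open>constant_gcd_2\<close>). In the other cases one of
  \<open>(0,1,1,0,\<dots>,0)\<close> for even \<open>r\<close>, \<open>(0,\<dots>,0,1)\<close> for odd \<open>r\<close> and even \<open>p\<close>, and
  \<open>(0,\<dots>,0,1,2,\<dots>,2,1)\<close> for odd \<open>r\<close> and even \<open>q\<close>, repeated periodically, attains the bound.
\<close>

section \<open>Colorings as sequences of color lists\<close>

text \<open>
  Recursion on the position keeps the strands above the tile out of the way: a statement about a
  tile at position \<open>i\<close> reduces to the tile in the top position, where simplification settles it.
\<close>

fun step :: "tile \<Rightarrow> nat \<Rightarrow> int list \<Rightarrow> int list \<Rightarrow> bool" where
  "step Cup 0 v w \<longleftrightarrow> (\<exists>x. w = x # x # v)"
| "step Cap 0 v w \<longleftrightarrow> (\<exists>x. v = x # x # w)"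
| "step OverDown 0 v w \<longleftrightarrow> (\<exists>x y u. v = x # y # u \<and> w = (2 * x - y) # x # u)"
| "step OverUp 0 v w \<longleftrightarrow> (\<exists>x y u. v = x # y # u \<and> w = y # (2 * y - x) # u)"
| "step t (Suc i) v w \<longleftrightarrow> (\<exists>x v' w'. v = x # v' \<and> w = x # w' \<and> step t i v' w')"

text \<open>
  \<open>K\<close> collects the colors met between the left list \<open>v\<close> and the right list \<open>w\<close>, both included.
  Keeping it as an argument makes the number of colors of a coloring accessible.
\<close>

fun run :: "diagram \<Rightarrow> int list \<Rightarrow> int set \<Rightarrow> int list \<Rightarrow> bool" where
  "run [] v K w \<longleftrightarrow> v = w \<and> K = set v"
| "run ((t, i) # D) v K w \<longleftrightarrow> (\<exists>u L. step t i v u \<and> run D u L w \<and> K = set v \<union> L)"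

text \<open>
  Validity of the slices when the diagram starts with \<open>n\<close> strands; the recursion allows to cut a
  diagram at any vertical line.
\<close>

fun fits :: "nat \<Rightarrow> diagram \<Rightarrow> bool" where
  "fits n [] \<longleftrightarrow> True"
| "fits n ((t, i) # D) \<longleftrightarrow> i + ins t \<le> n \<and> fits (n - ins t + outs t) D"

lemma step_length:
  "step t i v w \<Longrightarrow> i + ins t \<le> length v \<and> length w = length v - ins t + outs t"
proof (induction t i v w rule: step.induct)
qed (auto, fastforce+)

lemma run_append:
  "run (A @ B) v K w \<longleftrightarrow> (\<exists>u L M. run A v L u \<and> run B u M w \<and> K = L \<union> M)"
proof (induction A arbitrary: v K)
  case Nil
  have "set v \<subseteq> M" if "run B v M w" for M
    using that by (cases B) auto
  then show ?case by (auto simp: Un_absorb1)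
next
  case (Cons s A)
  then show ?case by (cases s) (simp, blast)
qed

lemma run_finite: "run D v K w \<Longrightarrow> finite K"
  by (induction D v K w rule: run.induct) auto

lemma run_ends: "run D v K w \<Longrightarrow> set v \<subseteq> K \<and> set w \<subseteq> K"
  by (induction D v K w rule: run.induct) auto

lemma fits_append: "fits n (A @ B) \<Longrightarrow> fits n A"
  by (induction n A rule: fits.induct) auto

lemma run_fits: "run D v K w \<Longrightarrow> fits (length v) D"
proof (induction D arbitrary: v K)
  case (Cons s D)
  obtain t i where s: "s = (t, i)" by fastforce
  with Cons.prems obtain u L where u: "step t i v u" "run D u L w" by auto
  from step_length[OF u(1)] Cons.IH[OF u(2)] s show ?case by simp
qed simp

lemma fits_after_run: "run A v K u \<Longrightarrow> fits (length v) (A @ B) \<Longrightarrow> fits (length u) B"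
proof (induction A arbitrary: v K)
  case (Cons s A)
  obtain t i where s: "s = (t, i)" by fastforce
  with Cons.prems obtain L x where x: "step t i v x" "run A x L u" by auto
  from step_length[OF x(1)] Cons.prems s have "fits (length x) (A @ B)" by simp
  from Cons.IH[OF x(2) this] show ?case .
qed simp

lemma foldl_fits:
  "(\<forall>k < length D. snd (D ! k) + ins (fst (D ! k)) \<le> foldl (\<lambda>w (t, i). w - ins t + outs t) n (take k D))
    \<longleftrightarrow> fits n D"
  by (induction n D rule: fits.induct) (simp_all add: All_less_Suc2)

lemma link_diagram_fits: "link_diagram D \<longleftrightarrow> fits 0 D \<and> width D = 0"
  by (simp add: link_diagram_def width_def flip: foldl_fits)

lemma run_width: "run D v K w \<Longrightarrow> length w = foldl (\<lambda>w (t, i). w - ins t + outs t) (length v) D"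
  by (induction D arbitrary: v K) (auto dest!: step_length)

lemma run_link_diagram: "run D [] K [] \<Longrightarrow> link_diagram D"
  using run_fits[of D "[]" K "[]"] run_width[of D "[]" K "[]"]
  by (simp add: link_diagram_fits width_def)

text \<open>
  The second conjunct is what makes nontriviality survive a move: constant lists outside force
  constant colors inside. The condition \<open>fits\<close> is needed because a move may delete all slices, and
  then a list too short for the tiles would have to be extended.
\<close>

definition sub_move :: "diagram \<Rightarrow> diagram \<Rightarrow> bool" where
  "sub_move l r \<longleftrightarrow>
     (\<forall>v K w. run l v K w \<longrightarrow> fits (length v) r \<longrightarrow>
        (\<exists>L. run r v L w) \<and> (\<forall>c. set v \<union> set w \<subseteq> {c} \<longrightarrow> K \<subseteq> {c}))"

abbreviation lower :: "diagram \<Rightarrow> diagram" where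
  "lower D \<equiv> map (\<lambda>(t, i). (t, Suc i)) D"

lemma run_lower: "run D v K w \<Longrightarrow> run (lower D) (x # v) (insert x K) (x # w)"
  by (induction D v K w rule: run.induct) auto

text \<open>
  Below an additional top strand nothing changes. This and the next lemmas reduce local moves to
  moves that touch the top strand.
\<close>

lemma run_lowerD:
  "run (lower D) (x # v) K w \<Longrightarrow> \<exists>L w'. w = x # w' \<and> K = insert x L \<and> run D v L w'"
proof (induction D arbitrary: v K)
  case Nil
  then show ?case by auto
next
  case (Cons s D)
  obtain t i where s: "s = (t, i)" by fastforce
  from Cons.prems s obtain u L where u: "step t i v u" "run (lower D) (x # u) L w" "K = insert x (set v) \<union> L"
    by auto
  from Cons.IH[OF u(2)] obtain M w' where "w = x # w'" "L = insert x M" "run D u M w'" by blast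
  with u s show ?case by (intro exI[of _ "set v \<union> M"] exI[of _ w']) auto
qed

lemma fits_lower: "D \<noteq> [] \<Longrightarrow> fits n (lower D) \<Longrightarrow> 0 < n"
  by (cases D) auto

lemma fits_lowerD: "fits (Suc n) (lower D) \<Longrightarrow> fits n D"
  by (induction n D rule: fits.induct) (auto simp: Suc_diff_le)

lemma sub_move_lower:
  assumes "sub_move l r" and ne: "l \<noteq> [] \<or> r \<noteq> []"
  shows "sub_move (lower l) (lower r)"
  unfolding sub_move_def
proof (intro allI impI)
  fix v K w
  assume run: "run (lower l) v K w" and fits: "fits (length v) (lower r)"
  have "0 < length v"
    using ne fits_lower[OF _ fits] fits_lower[OF _ run_fits[OF run]] by blast
  then obtain x v' where v: "v = x # v'" by (cases v) auto
  obtain L w' where w: "w = x # w'" "K = insert x L" "run l v' L w'"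
    using run_lowerD run v by blast
  have "fits (length v') r" using fits v fits_lowerD by simp
  with assms(1) w(3) obtain M where "run r v' M w'" "\<forall>c. set v' \<union> set w' \<subseteq> {c} \<longrightarrow> L \<subseteq> {c}"
    unfolding sub_move_def by blast
  then show "(\<exists>L. run (lower r) v L w) \<and> (\<forall>c. set v \<union> set w \<subseteq> {c} \<longrightarrow> K \<subseteq> {c})"
    using v w by (auto intro: run_lower)
qed

lemma sub_move_shift:
  assumes "sub_move l r" and "l \<noteq> [] \<or> r \<noteq> []"
  shows "sub_move (map (\<lambda>(t, k). (t, k + i)) l) (map (\<lambda>(t, k). (t, k + i)) r)"
proof (induction i)
  case (Suc i)
  have eq: "map (\<lambda>(t, k). (t, k + Suc i)) D = lower (map (\<lambda>(t, k). (t, k + i)) D)" for D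
    by (auto simp: case_prod_unfold)
  show ?case unfolding eq using Suc assms(2) by (intro sub_move_lower) auto
qed (simp add: assms case_prod_unfold)

text \<open>
  Tiles without a common strand act on disjoint parts of the list, hence in either order, and the
  list in between is composed of parts of the two outer ones.
\<close>

lemma sub_move_exchange_top:
  "sub_move [(s, 0), (t, outs s + j)] [(t, ins s + j), (s, 0)]"
  "sub_move [(t, ins s + j), (s, 0)] [(s, 0), (t, outs s + j)]"
  unfolding sub_move_def by (cases s; auto simp: numeral_2_eq_2; blast)+

definition equi_move :: "diagram \<Rightarrow> diagram \<Rightarrow> bool" where
  "equi_move l r \<longleftrightarrow> sub_move l r \<and> sub_move r l"

lemma equi_move_lift:
  assumes "equi_move (map (\<lambda>(t, k). (t, k - i)) l) (map (\<lambda>(t, k). (t, k - i)) r)"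
    and "l \<noteq> []" "\<forall>s \<in> set (l @ r). i \<le> snd s"
  shows "equi_move l r"
proof -
  have eq: "map (\<lambda>(t, k). (t, k + i)) (map (\<lambda>(t, k). (t, k - i)) D) = D" if "\<forall>s \<in> set D. i \<le> snd s" for D
    using that by (auto simp: case_prod_unfold intro!: map_idI)
  show ?thesis
    using assms sub_move_shift[of "map (\<lambda>(t, k). (t, k - i)) l" "map (\<lambda>(t, k). (t, k - i)) r" i]
      sub_move_shift[of "map (\<lambda>(t, k). (t, k - i)) r" "map (\<lambda>(t, k). (t, k - i)) l" i]
    by (simp add: equi_move_def eq del: map_map)
qed

lemma length_ge_1: "Suc 0 \<le> length v \<longleftrightarrow> (\<exists>x u. v = x # u)"
  by (cases v) auto

lemma length_ge_2: "Suc (Suc 0) \<le> length v \<longleftrightarrow> (\<exists>x y u. v = x # y # u)"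
  by (cases v; cases "tl v") auto

lemma length_ge_3: "Suc (Suc (Suc 0)) \<le> length v \<longleftrightarrow> (\<exists>x y z u. v = x # y # z # u)"
  by (cases v; cases "tl v"; cases "tl (tl v)") auto

text \<open>
  The reversed \<open>ex_simps\<close> bring the intermediate lists into prenex form, where their defining
  equations eliminate them; the default orientation would push the quantifiers inwards and leave
  an unbounded search for witnesses.
\<close>

lemmas top_move_simps = equi_move_def sub_move_def numeral_2_eq_2 numeral_3_eq_3
  length_ge_1 length_ge_2 length_ge_3 ex_simps(1,2)[symmetric]

text \<open>
  For the three Reidemeister moves this is the usual invariance of colorings under the operation
  \<open>(x, y) \<mapsto> 2 x - y\<close>, which is idempotent, involutive and self-distributive.
\<close>

lemma local_move_equi: "local_move l r \<Longrightarrow> equi_move l r"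
proof (induction rule: local_move.induct)
  case (exchange s i t j)
  show ?case
    by (rule equi_move_lift[of i]) (use sub_move_exchange_top[where s = s and t = t and j = j] in \<open>simp_all add: equi_move_def add.assoc\<close>)
next
  case (zigzag1 i)
  show ?case by (rule equi_move_lift[of i], (simp add: top_move_simps del: ex_simps; auto), simp_all)
next
  case (zigzag2 i)
  show ?case by (rule equi_move_lift[of i], (simp add: top_move_simps del: ex_simps; auto), simp_all)
next
  case (turn1 i)
  show ?case by (rule equi_move_lift[of i], (simp add: top_move_simps del: ex_simps; auto), simp_all)
next
  case (turn2 i)
  show ?case by (rule equi_move_lift[of i], (simp add: top_move_simps del: ex_simps; auto), simp_all)
next
  case (turn3 i)
  show ?case by (rule equi_move_lift[of i], (simp add: top_move_simps del: ex_simps; auto), simp_all)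
next
  case (turn4 i)
  show ?case by (rule equi_move_lift[of i], (simp add: top_move_simps del: ex_simps; auto), simp_all)
next
  case (R1a i)
  show ?case by (rule equi_move_lift[of i], (simp add: top_move_simps del: ex_simps; auto), simp_all)
next
  case (R1b i)
  show ?case by (rule equi_move_lift[of i], (simp add: top_move_simps del: ex_simps; auto), simp_all)
next
  case (R1c i)
  show ?case by (rule equi_move_lift[of i], (simp add: top_move_simps del: ex_simps; auto), simp_all)
next
  case (R1d i)
  show ?case by (rule equi_move_lift[of i], (simp add: top_move_simps del: ex_simps; auto), simp_all)
next
  case (R2a i)
  show ?case by (rule equi_move_lift[of i], (simp add: top_move_simps del: ex_simps; auto), simp_all)
next
  case (R2b i)
  show ?case by (rule equi_move_lift[of i], (simp add: top_move_simps del: ex_simps; auto), simp_all)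
next
  case (R3 i)
  show ?case by (rule equi_move_lift[of i], (simp add: top_move_simps del: ex_simps; auto), simp_all)
qed

lemma diagram_move_run:
  assumes "sub_move l r" "link_diagram (A @ r @ B)"
    and "run (A @ l @ B) [] K []" "\<nexists>c. K \<subseteq> {c}"
  shows "\<exists>K. run (A @ r @ B) [] K [] \<and> (\<nexists>c. K \<subseteq> {c})"
proof -
  obtain v w L M N where runs: "run A [] L v" "run l v M w" "run B w N []" "K = L \<union> M \<union> N"
    using assms(3) unfolding run_append by blast
  have "fits (length v) r"
    using fits_append[of "length v" r B] fits_after_run[OF runs(1), of "r @ B"] assms(2)
    by (simp add: link_diagram_fits)
  then obtain M' where M': "run r v M' w" "\<forall>c. set v \<union> set w \<subseteq> {c} \<longrightarrow> M \<subseteq> {c}"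
    using assms(1) runs(2) unfolding sub_move_def by blast
  have "run (A @ r @ B) [] (L \<union> (M' \<union> N)) []"
    using runs M' unfolding run_append by blast
  \<comment> \<open>The outer parts are untouched, so a constant new coloring would make the old one constant.\<close>
  moreover have "\<nexists>c. L \<union> (M' \<union> N) \<subseteq> {c}"
  proof
    assume "\<exists>c. L \<union> (M' \<union> N) \<subseteq> {c}"
    then obtain c where c: "L \<subseteq> {c}" "M' \<subseteq> {c}" "N \<subseteq> {c}" by auto
    then have "set v \<union> set w \<subseteq> {c}" using run_ends[OF M'(1)] by blast
    with M'(2) have "M \<subseteq> {c}" by simp
    then have "K \<subseteq> {c}" using c runs(4) by simp
    then show False using assms(4) by blast
  qed
  ultimately show ?thesis by blast
qed

definition colorable_diagram :: "diagram \<Rightarrow> bool" where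
  "colorable_diagram D \<longleftrightarrow> (\<exists>K. run D [] K [] \<and> (\<nexists>c. K \<subseteq> {c}))"

lemma diagram_move_colorable:
  "diagram_move D D' \<Longrightarrow> colorable_diagram D \<longleftrightarrow> colorable_diagram D'"
proof -
  assume "diagram_move D D'"
  then obtain A B l r where D: "link_diagram D" "link_diagram D'" "local_move l r"
    "D = A @ l @ B" "D' = A @ r @ B"
    unfolding diagram_move_def by blast
  from local_move_equi[OF D(3)] have "sub_move l r" "sub_move r l" by (simp_all add: equi_move_def)
  with D show ?thesis
    unfolding colorable_diagram_def using diagram_move_run[of l r A B] diagram_move_run[of r l A B] by blast
qed

lemma equivclp_invariant:
  assumes "equivclp R x y" "\<And>x y. R x y \<Longrightarrow> P x = P y"
  shows "P x = P y"
  using assms(1) by (induction rule: equivclp_induct) (use assms(2) in auto)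

section \<open>Arcs and color lists\<close>

text \<open>
  The color lists as a function of the vertical line, the form in which they can be compared with
  colors of points.
\<close>

lemma run_states:
  "run D v K w \<longleftrightarrow> (\<exists>\<sigma>. \<sigma> 0 = v \<and> \<sigma> (length D) = w \<and>
     (\<forall>k < length D. step (fst (D ! k)) (snd (D ! k)) (\<sigma> k) (\<sigma> (Suc k))) \<and>
     K = (\<Union>k \<le> length D. set (\<sigma> k)))"
proof (induction D arbitrary: v K)
  case Nil
  then show ?case by (auto intro: exI[of _ "\<lambda>_. v"])
next
  case (Cons s D)
  obtain t i where s: "s = (t, i)" by fastforce
  show ?case (is "_ \<longleftrightarrow> (\<exists>\<sigma>. ?P \<sigma>)")
  proof
    assume "run (s # D) v K w"
    then obtain u L where u: "step t i v u" "run D u L w" "K = set v \<union> L" using s by auto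
    from u(2) obtain \<sigma> where \<sigma>: "\<sigma> 0 = u" "\<sigma> (length D) = w" "L = (\<Union>k \<le> length D. set (\<sigma> k))"
      "\<forall>k < length D. step (fst (D ! k)) (snd (D ! k)) (\<sigma> k) (\<sigma> (Suc k))"
      unfolding Cons.IH by blast
    have "?P (case_nat v \<sigma>)"
      using u \<sigma> s by (auto simp: All_less_Suc2 atMost_Suc_eq_insert_0)
    then show "\<exists>\<sigma>. ?P \<sigma>" by (rule exI[where x = "case_nat v \<sigma>"])
  next
    assume "\<exists>\<sigma>. ?P \<sigma>"
    then obtain \<sigma> where \<sigma>: "?P \<sigma>" ..
    then have "run D (\<sigma> 1) (\<Union>k \<le> length D. set (\<sigma> (Suc k))) w"
      unfolding Cons.IH by (intro exI[of _ "\<sigma> \<circ> Suc"]) (auto simp: All_less_Suc2)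
    with \<sigma> s show "run (s # D) v K w"
      by (auto simp: All_less_Suc2 atMost_Suc_eq_insert_0 intro!: exI[of _ "\<sigma> 1"])
  qed
qed

text \<open>
  Here \<open>n\<close> is the number of strands to the left of the slice, \<open>v\<close> and \<open>w\<close> are the colors on its
  two sides; only the values at existing strands matter.
\<close>

definition slice_coloring :: "slice \<Rightarrow> nat \<Rightarrow> (nat \<Rightarrow> int) \<Rightarrow> (nat \<Rightarrow> int) \<Rightarrow> bool" where
  "slice_coloring s n v w \<longleftrightarrow> (case s of (t, i) \<Rightarrow>
     (\<forall>j < i. v j = w j) \<and> (\<forall>j. i + ins t + j < n \<longrightarrow> v (i + ins t + j) = w (i + outs t + j)) \<and>
     (case t of Cup \<Rightarrow> w i = w (i + 1) | Cap \<Rightarrow> v i = v (i + 1)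
      | OverDown \<Rightarrow> v i = w (i + 1) \<and> 2 * v i = v (i + 1) + w i
      | OverUp \<Rightarrow> v (i + 1) = w i \<and> 2 * v (i + 1) = v i + w (i + 1)))"

lemma slice_coloring_step:
  "i + ins t \<le> n \<Longrightarrow> slice_coloring (t, i) n v w \<longleftrightarrow> step t i (map v [0..<n]) (map w [0..<n - ins t + outs t])"
proof (induction i arbitrary: n v w)
  case 0
  define m where "m = n - ins t"
  have n: "n = ins t + m" using 0 m_def by simp
  have two: "map f [0..<Suc (Suc k)] = f 0 # f (Suc 0) # map (\<lambda>j. f (Suc (Suc j))) [0..<k]" for f :: "nat \<Rightarrow> int" and k
    by (simp add: map_upt_Suc del: upt_Suc)
  show ?case unfolding n
    by (cases t) (auto simp: slice_coloring_def two numeral_2_eq_2 simp del: upt_Suc)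
next
  case (Suc i)
  obtain m where n: "n = Suc m" using Suc.prems by (cases n) auto
  have "slice_coloring (t, Suc i) n v w \<longleftrightarrow> v 0 = w 0 \<and> slice_coloring (t, i) m (v \<circ> Suc) (w \<circ> Suc)"
    by (cases t) (auto simp: slice_coloring_def n All_less_Suc2)
  also have "\<dots> \<longleftrightarrow> step t (Suc i) (map v [0..<n]) (map w [0..<n - ins t + outs t])"
    using Suc.IH[of m] Suc.prems n by (auto simp: map_upt_Suc Suc_diff_le comp_def simp del: upt_Suc)
  finally show ?case .
qed

definition point_coloring :: "diagram \<Rightarrow> (point \<Rightarrow> int) \<Rightarrow> bool" where
  "point_coloring D f \<longleftrightarrow> (\<forall>x y. joined D x y \<longrightarrow> f x = f y) \<and>
     (\<forall>k i. k < length D \<longrightarrow>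
       (D ! k = (OverDown, i) \<longrightarrow> 2 * f (k, i) = f (k, i + 1) + f (Suc k, i)) \<and>
       (D ! k = (OverUp, i) \<longrightarrow> 2 * f (k, i + 1) = f (k, i) + f (Suc k, i + 1)))"

lemma point_coloring_slices:
  "point_coloring D f \<longleftrightarrow>
     (\<forall>k < length D. slice_coloring (D ! k) (width (take k D)) (\<lambda>j. f (k, j)) (\<lambda>j. f (Suc k, j)))"
proof
  assume f: "point_coloring D f"
  show "\<forall>k < length D. slice_coloring (D ! k) (width (take k D)) (\<lambda>j. f (k, j)) (\<lambda>j. f (Suc k, j))"
  proof (intro allI impI)
    fix k assume k: "k < length D"
    obtain t i where s: "D ! k = (t, i)" by fastforce
    show "slice_coloring (D ! k) (width (take k D)) (\<lambda>j. f (k, j)) (\<lambda>j. f (Suc k, j))"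
    proof -
      have J: "f x = f y" if "joined D x y" for x y
        using f that unfolding point_coloring_def by blast
      note j = J[OF joined.above[OF k s]] J[OF joined.below[OF k s]]
      show ?thesis
      proof (cases t)
        case Cup
        then show ?thesis using j s J[OF joined.cup[OF k]] by (simp add: slice_coloring_def)
      next
        case Cap
        then show ?thesis using j s J[OF joined.cap[OF k]] by (simp add: slice_coloring_def)
      next
        case OverDown
        then have "2 * f (k, i) = f (k, i + 1) + f (Suc k, i)" "f (k, i) = f (Suc k, i + 1)"
          using f k s J[OF joined.over_down[OF k]] unfolding point_coloring_def by blast+
        with OverDown show ?thesis using j s by (simp add: slice_coloring_def)
      next
        case OverUp
        then have "2 * f (k, i + 1) = f (k, i) + f (Suc k, i + 1)" "f (k, i + 1) = f (Suc k, i)"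
          using f k s J[OF joined.over_up[OF k]] unfolding point_coloring_def by blast+
        with OverUp show ?thesis using j s by (simp add: slice_coloring_def)
      qed
    qed
  qed
next
  assume *: "\<forall>k < length D. slice_coloring (D ! k) (width (take k D)) (\<lambda>j. f (k, j)) (\<lambda>j. f (Suc k, j))"
  have "f x = f y" if "joined D x y" for x y
    using that by cases (use * in \<open>fastforce simp: slice_coloring_def\<close>)+
  then show "point_coloring D f"
    using * by (fastforce simp: point_coloring_def slice_coloring_def)
qed

lemma width_Suc:
  "k < length D \<Longrightarrow> D ! k = (t, i) \<Longrightarrow> width (take (Suc k) D) = width (take k D) - ins t + outs t"
  by (simp add: width_def take_Suc_conv_app_nth)

lemma run_point_coloring:
  assumes D: "link_diagram D"
  shows "run D [] K [] \<longleftrightarrow> (\<exists>f. point_coloring D f \<and> f ` points D = K)"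
proof
  assume "run D [] K []"
  then obtain \<sigma> where \<sigma>: "\<sigma> 0 = []" "\<sigma> (length D) = []" "K = (\<Union>k \<le> length D. set (\<sigma> k))"
    "\<And>k. k < length D \<Longrightarrow> step (fst (D ! k)) (snd (D ! k)) (\<sigma> k) (\<sigma> (Suc k))"
    unfolding run_states by blast
  have len: "k \<le> length D \<Longrightarrow> length (\<sigma> k) = width (take k D)" for k
  proof (induction k)
    case (Suc k)
    obtain t i where s: "D ! k = (t, i)" by fastforce
    show ?case using Suc s step_length[OF \<sigma>(4)[of k]] width_Suc[of k D t i] by simp
  qed (simp add: \<sigma> width_def)
  define f :: "point \<Rightarrow> int" where "f = (\<lambda>(k, j). \<sigma> k ! j)"
  have \<sigma>f: "\<sigma> k = map (\<lambda>j. f (k, j)) [0..<width (take k D)]" if "k \<le> length D" for k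
    by (simp add: f_def len[OF that] list_eq_iff_nth_eq)
  have "point_coloring D f"
    unfolding point_coloring_slices
  proof (intro allI impI)
    fix k assume k: "k < length D"
    obtain t i where s: "D ! k = (t, i)" by fastforce
    have "i + ins t \<le> width (take k D)" using D k s unfolding link_diagram_def by auto
    then show "slice_coloring (D ! k) (width (take k D)) (\<lambda>j. f (k, j)) (\<lambda>j. f (Suc k, j))"
      using k s \<sigma>(4)[OF k] \<sigma>f[of k] \<sigma>f[of "Suc k"] by (simp add: slice_coloring_step width_Suc)
  qed
  moreover have "f ` points D = K"
    unfolding points_def \<sigma>(3) using \<sigma>f by (fastforce simp: image_iff)
  ultimately show "\<exists>f. point_coloring D f \<and> f ` points D = K" by blast
next
  assume "\<exists>f. point_coloring D f \<and> f ` points D = K"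
  then obtain f where f: "point_coloring D f" "f ` points D = K" by blast
  define \<sigma> where "\<sigma> k = map (\<lambda>j. f (k, j)) [0..<width (take k D)]" for k
  have "step (fst (D ! k)) (snd (D ! k)) (\<sigma> k) (\<sigma> (Suc k))" if k: "k < length D" for k
  proof -
    obtain t i where s: "D ! k = (t, i)" by fastforce
    have "i + ins t \<le> width (take k D)" using D k s unfolding link_diagram_def by auto
    moreover have "slice_coloring (D ! k) (width (take k D)) (\<lambda>j. f (k, j)) (\<lambda>j. f (Suc k, j))"
      using f(1) k unfolding point_coloring_slices by blast
    ultimately show ?thesis
      using k s by (simp add: slice_coloring_step width_Suc \<sigma>_def)
  qed
  moreover have "\<sigma> 0 = []" "\<sigma> (length D) = []"
    using D by (simp_all add: \<sigma>_def width_def link_diagram_def)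
  moreover have "K = (\<Union>k \<le> length D. set (\<sigma> k))"
    unfolding f(2)[symmetric] by (fastforce simp: points_def \<sigma>_def image_iff)
  ultimately show "run D [] K []"
    unfolding run_states by blast
qed

lemma joined_points:
  assumes "link_diagram D" "joined D x y"
  shows "x \<in> points D \<and> y \<in> points D"
proof -
  have *: "i + ins t \<le> width (take k D)" if "k < length D" "D ! k = (t, i)" for k t i
    using assms(1) that unfolding link_diagram_def by auto
  show ?thesis
    using assms(2) by cases (force simp: points_def width_Suc dest: *)+
qed

text \<open>
  Colorings of arcs are the same as colorings of points that are constant along \<open>joined\<close>: the
  latter are constant on arcs, and in a link diagram every crossing has its end points on arcs.
\<close>

lemma Z_coloring_points:
  assumes D: "link_diagram D"
  shows "(\<exists>\<gamma>. Z_coloring D \<gamma> \<and> \<gamma> ` arcs D = K) \<longleftrightarrow> (\<exists>f. point_coloring D f \<and> f ` points D = K)"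
proof -
  have same: "same_arc D `` {x} = same_arc D `` {y}" if "joined D x y" for x y
  proof -
    have "equivclp (joined D) x y" using that by (rule r_into_equivclp)
    then have "equivclp (joined D) x = equivclp (joined D) y"
      by (intro ext) (meson equivclp_sym equivclp_trans)
    then show ?thesis
      using joined_points[OF D that] by (auto simp: same_arc_def)
  qed
  have cross: "(k, i) \<in> points D" "(k, Suc i) \<in> points D" "(Suc k, i) \<in> points D" "(Suc k, Suc i) \<in> points D"
    if "k < length D" "D ! k = (t, i)" "ins t = 2" "outs t = 2" for k t i
  proof -
    have "snd (D ! k) + ins (fst (D ! k)) \<le> width (take k D)"
      using D that(1) unfolding link_diagram_def by blast
    then show "(k, i) \<in> points D" "(k, Suc i) \<in> points D" "(Suc k, i) \<in> points D" "(Suc k, Suc i) \<in> points D"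
      using that by (auto simp: points_def width_Suc)
  qed
  show ?thesis
  proof
    assume "\<exists>\<gamma>. Z_coloring D \<gamma> \<and> \<gamma> ` arcs D = K"
    then obtain \<gamma> where \<gamma>: "Z_coloring D \<gamma>" "\<gamma> ` arcs D = K" by blast
    have "point_coloring D (\<gamma> \<circ> arc_of D)"
      unfolding point_coloring_def
    proof (intro conjI allI impI)
      fix x y assume "joined D x y"
      then show "(\<gamma> \<circ> arc_of D) x = (\<gamma> \<circ> arc_of D) y" using same by (simp add: arc_of_def)
    qed (use \<gamma>(1) in \<open>fastforce simp: Z_coloring_def crossings_def\<close>)+
    moreover have "(\<gamma> \<circ> arc_of D) ` points D = K"
      using \<gamma>(2) by (auto simp: arcs_def quotient_def arc_of_def)
    ultimately show "\<exists>f. point_coloring D f \<and> f ` points D = K" by blast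
  next
    assume "\<exists>f. point_coloring D f \<and> f ` points D = K"
    then obtain f where f: "point_coloring D f" "f ` points D = K" by blast
    define \<gamma> where "\<gamma> A = f (SOME x. x \<in> A)" for A
    have eq: "f x = f y" if "equivclp (joined D) x y" for x y
      using that by (rule equivclp_invariant) (use f(1) in \<open>auto simp: point_coloring_def\<close>)
    have \<gamma>: "\<gamma> (arc_of D x) = f x" if "x \<in> points D" for x
    proof -
      have "f y = f x" if "y \<in> arc_of D x" for y
        using that eq[of x y] by (simp add: arc_of_def same_arc_def)
      moreover have "x \<in> arc_of D x" using that by (simp add: arc_of_def same_arc_def)
      ultimately show ?thesis unfolding \<gamma>_def by (metis someI)
    qed
    have "Z_coloring D \<gamma>"
      unfolding Z_coloring_def crossings_def
      using f(1) by (auto simp: \<gamma> cross point_coloring_def)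
    moreover have "\<gamma> ` arcs D = K"
    proof -
      have "arcs D = arc_of D ` points D" by (auto simp: arcs_def quotient_def arc_of_def)
      then show ?thesis using f(2) \<gamma> by (simp add: image_image)
    qed
    ultimately show "\<exists>\<gamma>. Z_coloring D \<gamma> \<and> \<gamma> ` arcs D = K" by blast
  qed
qed

lemma nontrivial_Z_coloring_run:
  assumes "link_diagram D"
  shows "(\<exists>\<gamma>. nontrivial_Z_coloring D \<gamma> \<and> \<gamma> ` arcs D = K) \<longleftrightarrow> run D [] K [] \<and> (\<nexists>c. K \<subseteq> {c})"
proof -
  have "(\<exists>a\<in>A. \<exists>b\<in>A. \<gamma> a \<noteq> \<gamma> b) \<longleftrightarrow> (\<nexists>c. \<gamma> ` A \<subseteq> {c})" for A and \<gamma> :: "point set \<Rightarrow> int"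
    unfolding image_subset_iff singleton_iff by metis
  then have "nontrivial_Z_coloring D \<gamma> \<longleftrightarrow> Z_coloring D \<gamma> \<and> (\<nexists>c. \<gamma> ` arcs D \<subseteq> {c})" for \<gamma>
    unfolding nontrivial_Z_coloring_def by simp
  then have "(\<exists>\<gamma>. nontrivial_Z_coloring D \<gamma> \<and> \<gamma> ` arcs D = K) \<longleftrightarrow>
      (\<exists>\<gamma>. Z_coloring D \<gamma> \<and> \<gamma> ` arcs D = K) \<and> (\<nexists>c. K \<subseteq> {c})"
    by blast
  then show ?thesis
    unfolding Z_coloring_points[OF assms] run_point_coloring[OF assms] .
qed

text \<open>
  Colorability is defined through some diagram of the link; invariance under moves transfers it to
  any given diagram.
\<close>

lemma Z_colorable_link_of:
  assumes "link_diagram D"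
  shows "Z_colorable (link_of D) \<longleftrightarrow> colorable_diagram D"
proof -
  have same: "colorable_diagram D = colorable_diagram D'" and link: "link_diagram D'" if "D' \<in> link_of D" for D'
  proof -
    have eq: "equivclp diagram_move D D'" using that by (simp add: link_of_def)
    from eq show "colorable_diagram D = colorable_diagram D'"
      by (rule equivclp_invariant) (rule diagram_move_colorable)
    from eq have "link_diagram D = link_diagram D'"
      by (rule equivclp_invariant) (simp add: diagram_move_def)
    with assms show "link_diagram D'" by simp
  qed
  have "(\<exists>\<gamma>. nontrivial_Z_coloring D' \<gamma>) \<longleftrightarrow> colorable_diagram D" if "D' \<in> link_of D" for D'
  proof -
    have "(\<exists>\<gamma>. nontrivial_Z_coloring D' \<gamma>) \<longleftrightarrow>
        (\<exists>K. \<exists>\<gamma>. nontrivial_Z_coloring D' \<gamma> \<and> \<gamma> ` arcs D' = K)"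
      by blast
    then show ?thesis
      unfolding nontrivial_Z_coloring_run[OF link[OF that]] colorable_diagram_def[symmetric] same[OF that] .
  qed
  moreover have "D \<in> link_of D" by (simp add: link_of_def)
  ultimately show ?thesis unfolding Z_colorable_def by blast
qed

section \<open>Colorings of braid closures\<close>

text \<open>
  Reflecting a tile exchanges its two sides, because \<open>y \<mapsto> 2 x - y\<close> is an involution.
\<close>

lemma step_flip: "step (flip_tile t) i w v \<longleftrightarrow> step t i v w"
proof (induction t i v w rule: step.induct)
qed auto

lemma run_reflect: "run (reflect D) w K v \<longleftrightarrow> run D v K w"
proof (induction D arbitrary: v K)
  case Nil
  then show ?case by (auto simp: reflect_def)
next
  case (Cons s D)
  obtain t i where s: "s = (t, i)" by fastforce
  have eq: "reflect (s # D) = reflect D @ [(flip_tile t, i)]" by (simp add: reflect_def s)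
  show ?case
  proof
    assume "run (reflect (s # D)) w K v"
    then obtain u L where L: "run D u L w" "step t i v u" "K = L \<union> (set u \<union> set v)"
      unfolding eq run_append Cons.IH by (auto simp: step_flip)
    with run_ends[OF L(1)] show "run (s # D) v K w" unfolding s run.simps by blast
  next
    assume "run (s # D) v K w"
    then obtain u L where L: "step t i v u" "run D u L w" "K = set v \<union> L"
      unfolding s by auto
    have "run [(flip_tile t, i)] u (set u \<union> set v) v" using L(1) by (simp add: step_flip)
    moreover have "K = L \<union> (set u \<union> set v)" using run_ends[OF L(2)] L(3) by blast
    ultimately show "run (reflect (s # D)) w K v"
      unfolding eq run_append Cons.IH using L(2) by blast
  qed
qed

lemma step_append_left:
  "step t (length xs + i) (xs @ v) w \<longleftrightarrow> (\<exists>w'. w = xs @ w' \<and> step t i v w')"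
  by (induction xs arbitrary: w) auto

lemma step_append_right:
  "i + ins t \<le> length v \<Longrightarrow> step t i (v @ z) w \<longleftrightarrow> (\<exists>w'. w = w' @ z \<and> step t i v w')"
proof (induction i arbitrary: v w)
  case 0
  then show ?case by (cases t) (auto simp: numeral_2_eq_2 length_ge_2)
next
  case (Suc i)
  then obtain x u where v: "v = x # u" by (cases v) auto
  show ?case unfolding v using Suc.IH[of u] Suc.prems v by (auto simp: Cons_eq_append_conv)
qed

lemma run_append_right:
  "fits (length v) D \<Longrightarrow>
    run D (v @ z) K w \<longleftrightarrow> (\<exists>w' L. w = w' @ z \<and> K = L \<union> set z \<and> run D v L w')"
proof (induction D arbitrary: v K)
  case (Cons s D)
  obtain t i where s: "s = (t, i)" by fastforce
  have *: "step t i v u \<Longrightarrow> fits (length u) D" for u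
    using Cons.prems s step_length[of t i v u] by simp
  have "i + ins t \<le> length v" using Cons.prems s by simp
  then have step: "step t i (v @ z) u \<longleftrightarrow> (\<exists>u'. u = u' @ z \<and> step t i v u')" for u
    by (rule step_append_right)
  show ?case unfolding s
  proof (intro iffI; (elim exE conjE)?)
    assume "run ((t, i) # D) (v @ z) K w"
    then obtain u L where u: "step t i v u" "run D (u @ z) L w" "K = set (v @ z) \<union> L"
      using step by auto
    then obtain w' M where w': "w = w' @ z" "L = M \<union> set z" "run D u M w'"
      using Cons.IH[OF *] by blast
    have "run ((t, i) # D) v (set v \<union> M) w'" using u(1) w'(3) by auto
    moreover have "K = set v \<union> M \<union> set z" using u(3) w'(2) by auto
    ultimately show "\<exists>w' L. w = w' @ z \<and> K = L \<union> set z \<and> run ((t, i) # D) v L w'"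
      using w'(1) by blast
  next
    fix w' L
    assume w: "w = w' @ z" "K = L \<union> set z" "run ((t, i) # D) v L w'"
    then obtain u M where u: "step t i v u" "run D u M w'" "L = set v \<union> M" by auto
    then have "step t i (v @ z) (u @ z)" "run D (u @ z) (M \<union> set z) w"
      using step Cons.IH[OF *] w(1) by blast+
    moreover have "K = set (v @ z) \<union> (M \<union> set z)" using u(3) w(2) by auto
    ultimately show "run ((t, i) # D) (v @ z) K w" by auto
  qed
qed auto

text \<open>
  Nested cups create every palindromic list. By reflection, the nested caps accept exactly these.
\<close>

lemma run_cups:
  "run (map (Pair Cup) [0..<b]) [] K u \<longleftrightarrow> (\<exists>v. length v = b \<and> u = v @ rev v \<and> K = set v)"
proof (induction b arbitrary: K u)
  case 0
  then show ?case by auto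
next
  case (Suc b)
  have step: "step Cup b (v @ rev v) u \<longleftrightarrow> (\<exists>x. u = v @ x # x # rev v)" if "length v = b" for v
    using step_append_left[of Cup v 0 "rev v" u] that by auto
  have "run [(Cup, b)] x M u \<longleftrightarrow> step Cup b x u \<and> M = set x \<union> set u" for x M
    by simp
  then have "run (map (Pair Cup) [0..<Suc b]) [] K u \<longleftrightarrow>
    (\<exists>v. length v = b \<and> step Cup b (v @ rev v) u \<and> K = set v \<union> (set (v @ rev v) \<union> set u))"
    unfolding upt_Suc_append[OF le0] map_append list.map run_append Suc.IH by blast
  also have "\<dots> \<longleftrightarrow> (\<exists>v x. length v = b \<and> u = v @ x # x # rev v \<and> K = insert x (set v))"
    using step by (intro iffI; elim exE conjE) (force, fastforce)
  also have "\<dots> \<longleftrightarrow> (\<exists>v. length v = Suc b \<and> u = v @ rev v \<and> K = set v)"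
  proof (intro iffI; elim exE conjE)
    fix v x assume "length v = b" "u = v @ x # x # rev v" "K = insert x (set v)"
    then show "\<exists>v. length v = Suc b \<and> u = v @ rev v \<and> K = set v"
      by (intro exI[of _ "v @ [x]"]) simp
  next
    fix v assume v: "length v = Suc b" "u = v @ rev v" "K = set v"
    then obtain v' x where "v = v' @ [x]" by (cases v rule: rev_cases) auto
    with v show "\<exists>v x. length v = b \<and> u = v @ x # x # rev v \<and> K = insert x (set v)"
      by auto
  qed
  finally show ?case .
qed

text \<open>
  The strands leading back below the braid keep their colors. Hence the palindromes at the two ends
  of the braid have the same second half, and therefore the same first half.
\<close>

lemma run_braid_closure:
  assumes "fits b w"
  shows "run (braid_closure b w) [] K [] \<longleftrightarrow> (\<exists>v. length v = b \<and> run w v K v)"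
proof -
  have caps: "map (Pair Cap) (rev [0..<b]) = reflect (map (Pair Cup) [0..<b])"
    by (simp add: reflect_def rev_map comp_def)
  have "run (braid_closure b w) [] K [] \<longleftrightarrow>
    (\<exists>v v' L. length v = b \<and> length v' = b \<and> run w (v @ rev v) L (v' @ rev v') \<and> K = set v \<union> (L \<union> set v'))"
    unfolding braid_closure_def caps run_append run_reflect run_cups by blast
  also have "\<dots> \<longleftrightarrow> (\<exists>v. length v = b \<and> run w v K v)"
  proof (intro iffI; (elim exE conjE)?)
    fix v v' L
    assume len: "length v = b" "length v' = b" and run: "run w (v @ rev v) L (v' @ rev v')"
      and K: "K = set v \<union> (L \<union> set v')"
    from run obtain u M where u: "v' @ rev v' = u @ rev v" "L = M \<union> set (rev v)" "run w v M u"
      using run_append_right[of v w "rev v"] assms len by auto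
    from u(1) len have "u = v'" "v' = v" by auto
    with u K run_ends[OF u(3)] have "K = M" by auto
    with u \<open>u = v'\<close> \<open>v' = v\<close> len show "\<exists>v. length v = b \<and> run w v K v" by blast
  next
    fix v assume len: "length v = b" and run: "run w v K v"
    have "run w (v @ rev v) (K \<union> set (rev v)) (v @ rev v)"
      using run_append_right[of v w "rev v"] assms len run by blast
    moreover have "K = set v \<union> ((K \<union> set (rev v)) \<union> set v)" using run_ends[OF run] by auto
    ultimately show "\<exists>v v' L. length v = b \<and> length v' = b \<and> run w (v @ rev v) L (v' @ rev v') \<and> K = set v \<union> (L \<union> set v')"
      using len by blast
  qed
  finally show ?thesis .
qed

text \<open>
  The effect of the elementary braid on the color list.
\<close>

definition twist :: "int list \<Rightarrow> int list" where
  "twist v = map (\<lambda>y. 2 * hd v - y) (tl v) @ [hd v]"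

text \<open>
  The over strand is followed past the strands \<open>zs\<close>; the strands in \<open>ys\<close> have already been passed.
\<close>

lemma run_over_strand:
  "run (map (Pair OverDown) [length ys..<length ys + length zs]) (ys @ x # zs) K w \<longleftrightarrow>
     w = ys @ map (\<lambda>y. 2 * x - y) zs @ [x] \<and> K = set (ys @ x # zs) \<union> set w"
proof (induction zs arbitrary: ys K)
  case Nil
  then show ?case by auto
next
  case (Cons z zs)
  have "[length ys..<length ys + length (z # zs)] =
    length ys # [length (ys @ [2 * x - z])..<length (ys @ [2 * x - z]) + length zs]"
    by (simp add: upt_rec)
  then have "run (map (Pair OverDown) [length ys..<length ys + length (z # zs)]) (ys @ x # z # zs) K w \<longleftrightarrow>
    (\<exists>L. run (map (Pair OverDown) [length (ys @ [2 * x - z])..<length (ys @ [2 * x - z]) + length zs])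
       ((ys @ [2 * x - z]) @ x # zs) L w \<and> K = set (ys @ x # z # zs) \<union> L)"
    using step_append_left[of OverDown ys 0 "x # z # zs"] by simp
  also have "\<dots> \<longleftrightarrow> w = ys @ map (\<lambda>y. 2 * x - y) (z # zs) @ [x] \<and> K = set (ys @ x # z # zs) \<union> set w"
    unfolding Cons.IH by auto
  finally show ?case .
qed

lemma run_elementary_braid:
  assumes "length v = b" "1 \<le> b"
  shows "run (elementary_braid b) v K w \<longleftrightarrow> w = twist v \<and> K = set v \<union> set w"
  using run_over_strand[of "[]" "tl v" "hd v" K w] assms
  by (cases v) (auto simp: elementary_braid_def twist_def)

lemma length_twist: "v \<noteq> [] \<Longrightarrow> length (twist v) = length v"
  by (simp add: twist_def)

lemma length_twists: "v \<noteq> [] \<Longrightarrow> length ((twist ^^ k) v) = length v"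
  by (induction k) (auto simp: length_twist simp flip: length_greater_0_conv)

lemma run_torus_braid:
  assumes "length v = b" "1 \<le> b"
  shows "run (concat (replicate n (elementary_braid b))) v K w \<longleftrightarrow>
    w = (twist ^^ n) v \<and> K = (\<Union>k \<le> n. set ((twist ^^ k) v))"
  using assms(1)
proof (induction n arbitrary: v K)
  case 0
  then show ?case by auto
next
  case (Suc n)
  have len: "length (twist v) = b" using Suc.prems assms(2) by (subst length_twist) auto
  have "run (concat (replicate (Suc n) (elementary_braid b))) v K w \<longleftrightarrow>
    w = (twist ^^ n) (twist v) \<and> K = set v \<union> set (twist v) \<union> (\<Union>k \<le> n. set ((twist ^^ k) (twist v)))"
    by (simp add: run_append run_elementary_braid[OF Suc.prems assms(2)] Suc.IH[OF len])
  moreover have "set (twist v) \<union> (\<Union>k \<le> n. set ((twist ^^ k) (twist v))) = (\<Union>k \<le> n. set ((twist ^^ k) (twist v)))"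
    by force
  ultimately show ?case
    by (simp add: atMost_Suc_eq_insert_0 funpow_swap1 Un_assoc)
qed

text \<open>
  A reflected braid has the same fixed lists, traversed in the opposite direction. As the fixed list
  returns after \<open>\<bar>a\<bar>\<close> twists, the colors met are those of the whole orbit; the exponent
  of \<open>twist\<close> can therefore range over all numbers.
\<close>

lemma run_standard_diagram:
  assumes "1 \<le> b" "a \<noteq> 0"
  shows "run (standard_diagram a b) [] K [] \<longleftrightarrow>
    (\<exists>v. length v = b \<and> (twist ^^ nat \<bar>a\<bar>) v = v \<and> K = (\<Union>k. set ((twist ^^ k) v)))"
proof -
  let ?n = "nat \<bar>a\<bar>" and ?w = "concat (replicate (nat \<bar>a\<bar>) (elementary_braid b))"
  have run: "run (torus_braid a b) v K v \<longleftrightarrow> run ?w v K v" for v K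
    by (simp add: torus_braid_def run_reflect Let_def)
  have fits: "fits b (torus_braid a b)"
  proof (cases "a < 0")
    case True
    let ?v = "(twist ^^ ?n) (replicate b 0)"
    have "\<exists>K. run (torus_braid a b) ?v K (replicate b 0)"
      using True run_torus_braid[of "replicate b 0" b ?n] assms(1) by (simp add: torus_braid_def run_reflect Let_def)
    then show ?thesis using run_fits length_twists[of "replicate b 0" ?n] assms(1) by fastforce
  next
    case False
    have "\<exists>K w. run (torus_braid a b) (replicate b 0) K w"
      using False run_torus_braid[of "replicate b 0" b ?n] assms(1) by (simp add: torus_braid_def Let_def)
    then show ?thesis using run_fits by fastforce
  qed
  have period: "(\<Union>k \<le> ?n. set ((twist ^^ k) v)) = (\<Union>k. set ((twist ^^ k) v))"
    if "(twist ^^ ?n) v = v" for v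
  proof -
    have "set ((twist ^^ k) v) = set ((twist ^^ (k mod ?n)) v)" for k
      using funpow_mod_eq[OF that] by simp
    moreover have "k mod ?n \<le> ?n" for k using assms(2) by (simp add: less_imp_le)
    ultimately show ?thesis by blast
  qed
  show ?thesis
    unfolding standard_diagram_def run_braid_closure[OF fits] run
    using run_torus_braid[OF _ assms(1)] period by force
qed

definition alt_sum :: "(nat \<Rightarrow> int) \<Rightarrow> nat \<Rightarrow> int" where
  "alt_sum c k = (\<Sum>i<k. (-1) ^ i * c i)"

text \<open>
  The isometry \<open>g\<^sub>k\<close>: the product of the point reflections \<open>x \<mapsto> 2 c\<^sub>i - x\<close> for \<open>i = 0, \<dots>, k - 1\<close>, with the
  reflection of index \<open>0\<close> applied last.
\<close>

definition transport :: "(nat \<Rightarrow> int) \<Rightarrow> nat \<Rightarrow> int \<Rightarrow> int" where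
  "transport c k x = 2 * alt_sum c k + (-1) ^ k * x"

text \<open>
  The next elementary braid reflects at \<open>g\<^sub>k(c\<^sub>k)\<close>, and the reflection at \<open>g\<^sub>k(c\<^sub>k)\<close> composed with
  \<open>g\<^sub>k\<close> is \<open>g\<^sub>k\<close> composed with the reflection at \<open>c\<^sub>k\<close>. Since this reflection fixes \<open>c\<^sub>k\<close>, the last
  entry of the new list has the required form as well.
\<close>

lemma twists_transport:
  assumes "\<And>i. c (i + b) = c i" "1 \<le> b"
  shows "(twist ^^ k) (map c [0..<b]) = map (\<lambda>j. transport c k (c (k + j))) [0..<b]"
proof (induction k)
  case 0
  then show ?case by (simp add: transport_def alt_sum_def)
next
  case (Suc k)
  obtain m where b: "b = Suc m" using assms(2) by (cases b) auto
  have "(twist ^^ Suc k) (map c [0..<b]) = twist (map (\<lambda>j. transport c k (c (k + j))) [0..<Suc m])"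
    using Suc by (simp only: funpow.simps comp_apply b)
  also have "\<dots> = map (\<lambda>j. 2 * transport c k (c k) - transport c k (c (k + Suc j))) [0..<m] @ [transport c k (c k)]"
    by (simp add: twist_def map_upt_Suc del: upt_Suc)
  also have "\<dots> = map (\<lambda>j. transport c (Suc k) (c (Suc k + j))) [0..<Suc m]"
    using assms(1)[of k] by (simp add: b transport_def alt_sum_def algebra_simps)
  finally show ?case by (simp add: b)
qed

lemma periodic_mod:
  assumes "\<And>i. c (i + b) = c i"
  shows "c (i mod b) = c (i :: nat)"
proof -
  have "c (j + m * b) = c j" for j m
  proof (induction m)
    case (Suc m)
    have "c (j + Suc m * b) = c (j + m * b + b)" by (simp add: ac_simps)
    with Suc show ?case using assms by simp
  qed simp
  from this[of "i mod b" "i div b"] show ?thesis by (simp add: mult.commute)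
qed

lemma periodic_image:
  assumes "\<And>i. c (i + b) = c (i :: nat)" "1 \<le> b"
  shows "(\<lambda>j. c (k + j)) ` {..<b} = range c"
proof -
  have "\<exists>j<b. c i = c (k + j)" for i
  proof -
    let ?j = "(i + k * (b - 1)) mod b"
    have "c (k + ?j) = c ((k + (i + k * (b - 1)) mod b) mod b)"
      using periodic_mod[of c b] assms(1) by metis
    also have "\<dots> = c ((i + k * b) mod b)"
    proof -
      have "k + (i + k * (b - 1)) = i + k * b" using assms(2) by (cases b) auto
      then show ?thesis by (simp only: mod_add_right_eq)
    qed
    also have "\<dots> = c i" using periodic_mod[of c b i] assms(1) by simp
    finally show ?thesis using assms(2) by (intro exI[of _ ?j]) simp
  qed
  then show ?thesis by fastforce
qed

lemma run_standard_diagram_periodic: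
  assumes "1 \<le> b" "a \<noteq> 0"
  shows "run (standard_diagram a b) [] K [] \<longleftrightarrow>
    (\<exists>c. (\<forall>i. c (i + b) = c i) \<and> (\<forall>i. transport c (nat \<bar>a\<bar>) (c (nat \<bar>a\<bar> + i)) = c i) \<and>
       K = (\<Union>k. transport c k ` range c))"
proof -
  let ?n = "nat \<bar>a\<bar>"
  have fixed: "(twist ^^ ?n) v = v \<longleftrightarrow> (\<forall>i. transport c ?n (c (?n + i)) = c i)"
    and colors: "(\<Union>k. set ((twist ^^ k) v)) = (\<Union>k. transport c k ` range c)"
    if c: "\<And>i. c (i + b) = c i" and v: "v = map c [0..<b]" for c v
  proof -
    have mod: "c (i mod b) = c i" "c (k + i mod b) = c (k + i)" for i k
      using periodic_mod[of c b i] periodic_mod[of "\<lambda>i. c (k + i)" b i] c by (simp_all add: add.assoc[symmetric])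
    have "(twist ^^ ?n) v = v \<longleftrightarrow> (\<forall>i<b. transport c ?n (c (?n + i)) = c i)"
      unfolding v twists_transport[of c b, OF c assms(1)] by (auto simp: map_eq_conv)
    also have "\<dots> \<longleftrightarrow> (\<forall>i. transport c ?n (c (?n + i)) = c i)"
    proof
      assume *: "\<forall>i<b. transport c ?n (c (?n + i)) = c i"
      have "transport c ?n (c (?n + i mod b)) = c (i mod b)" for i using * assms(1) by simp
      then show "\<forall>i. transport c ?n (c (?n + i)) = c i" unfolding mod by blast
    qed simp
    finally show "(twist ^^ ?n) v = v \<longleftrightarrow> (\<forall>i. transport c ?n (c (?n + i)) = c i)" .
    have "set ((twist ^^ k) v) = transport c k ` range c" for k
      unfolding v twists_transport[of c b, OF c assms(1)] periodic_image[of c b k, OF c assms(1), symmetric]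
      by (simp add: image_image atLeast0LessThan)
    then show "(\<Union>k. set ((twist ^^ k) v)) = (\<Union>k. transport c k ` range c)" by simp
  qed
  show ?thesis
    unfolding run_standard_diagram[OF assms]
  proof (intro iffI; (elim exE conjE)?)
    fix v assume v: "length v = b" "(twist ^^ ?n) v = v" "K = (\<Union>k. set ((twist ^^ k) v))"
    have c: "v ! ((i + b) mod b) = v ! (i mod b)" for i by simp
    have "v = map (\<lambda>i. v ! (i mod b)) [0..<b]"
      using v(1) by (auto simp: list_eq_iff_nth_eq)
    with v fixed[OF c this] colors[OF c this]
    show "\<exists>c. (\<forall>i. c (i + b) = c i) \<and> (\<forall>i. transport c ?n (c (?n + i)) = c i) \<and>
       K = (\<Union>k. transport c k ` range c)"
      by (intro exI[of _ "\<lambda>i. v ! (i mod b)"]) simp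
  next
    fix c :: "nat \<Rightarrow> int"
    assume c: "\<forall>i. c (i + b) = c i" "\<forall>i. transport c ?n (c (?n + i)) = c i"
      "K = (\<Union>k. transport c k ` range c)"
    show "\<exists>v. length v = b \<and> (twist ^^ ?n) v = v \<and> K = (\<Union>k. set ((twist ^^ k) v))"
      using c fixed[of c] colors[of c] by (intro exI[of _ "map c [0..<b]"]) simp
  qed
qed

section \<open>Bounds for the colors of a periodic sequence\<close>

definition colors :: "(nat \<Rightarrow> int) \<Rightarrow> int set" where
  "colors c = (\<Union>k. transport c k ` range c)"

lemma alt_sum_simps [simp]:
  "alt_sum c 0 = 0" "alt_sum c (Suc k) = alt_sum c k + (-1) ^ k * c k"
  by (simp_all add: alt_sum_def)

lemma transport_colors: "transport c k (c j) \<in> colors c"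
  by (auto simp: colors_def)

lemma range_colors: "c j \<in> colors c"
  using transport_colors[of c 0 j] by (simp add: transport_def)

lemma colors_trivial_iff: "(\<exists>z. colors c \<subseteq> {z}) \<longleftrightarrow> (\<forall>k. c k = c (Suc k))"
proof
  assume "\<exists>z. colors c \<subseteq> {z}"
  then obtain z where "colors c \<subseteq> {z}" ..
  then have "c j = z" for j using range_colors[of c j] by blast
  then show "\<forall>k. c k = c (Suc k)" by simp
next
  assume *: "\<forall>k. c k = c (Suc k)"
  define z where "z = c 0"
  have c: "c k = z" for k by (induction k) (use * z_def in metis)+
  have "alt_sum c k = (if even k then 0 else z)" for k
    by (induction k) (simp_all add: c)
  then have "transport c k (c j) = z" for k j
    by (simp add: transport_def c)
  then have "colors c \<subseteq> {z}" by (auto simp: colors_def)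
  then show "\<exists>z. colors c \<subseteq> {z}" ..
qed

lemma transport_add_2:
  "transport c (k + 2) y = transport c k y + 2 * ((-1) ^ k * (c k - c (Suc k)))"
  by (simp add: transport_def algebra_simps)

text \<open>
  A place where two neighbouring strands have different colors. Every nonconstant sequence has one.
\<close>

locale color_step =
  fixes c :: "nat \<Rightarrow> int" and k :: nat
  assumes neq: "c k \<noteq> c (Suc k)" and finite: "finite (colors c)"
begin

abbreviation "d \<equiv> (-1) ^ k * (c k - c (Suc k))"
abbreviation "x \<equiv> transport c k (c (Suc k))"

lemma d_nonzero: "d \<noteq> 0"
  using neq by simp

text \<open>
  The terms are the images of \<open>c\<^sub>k\<^sub>+\<^sub>1\<close> and \<open>c\<^sub>k\<close> under \<open>g\<^sub>k\<close> and under \<open>g\<^sub>k\<^sub>+\<^sub>2\<close>, which differ by the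
  translation by \<open>2 d\<close>.
\<close>

lemma progression: "{x, x + d, x + 2 * d, x + 3 * d} \<subseteq> colors c"
proof -
  have 1: "x + d = transport c k (c k)" by (simp add: transport_def algebra_simps)
  have 2: "x + 2 * d = transport c (k + 2) (c (Suc k))" unfolding transport_add_2 by simp
  have 3: "x + 3 * d = transport c (k + 2) (c k)" unfolding transport_add_2 1[symmetric] by simp
  show ?thesis unfolding 1 2 3 by (simp add: transport_colors)
qed

lemma card_progression: "card {x, x + d, x + 2 * d, x + 3 * d} = 4"
  using d_nonzero by simp

lemma card_colors_ge_4: "4 \<le> card (colors c)"
  using card_mono[OF finite progression] card_progression by simp

lemma colors_eq_progression:
  assumes "card (colors c) < 5"
  shows "colors c = {x, x + d, x + 2 * d, x + 3 * d}"
  using card_seteq[OF finite progression] assms card_progression by simp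

text \<open>
  Besides \<open>g\<^sub>k(c\<^sub>j)\<close>, also its translate by \<open>2 d\<close> is a color, which leaves only the first two terms
  of the progression for \<open>g\<^sub>k(c\<^sub>j)\<close>.
\<close>

lemma two_valued:
  assumes "card (colors c) < 5"
  shows "c j = c k \<or> c j = c (Suc k)"
proof -
  let ?y = "transport c k (c j)"
  have "?y \<in> colors c" "?y + 2 * d \<in> colors c"
    using transport_colors[of c k j] transport_colors[of c "k + 2" j] unfolding transport_add_2 by simp_all
  then have "?y = x \<or> ?y = x + d"
    using d_nonzero unfolding colors_eq_progression[OF assms] by auto
  then show ?thesis by (auto simp: transport_def algebra_simps)
qed

text \<open>
  Modulo \<open>c\<^sub>k - c\<^sub>k\<^sub>+\<^sub>1\<close> the sequence is constant, so its alternating sums are known modulo this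
  difference.
\<close>

lemma alt_sum_mod:
  assumes "card (colors c) < 5"
  obtains E where "alt_sum c n = (if odd n then c (Suc k) else 0) + (c k - c (Suc k)) * E"
proof -
  have "\<exists>E. alt_sum c n = (if odd n then c (Suc k) else 0) + (c k - c (Suc k)) * E"
  proof (induction n)
    case 0
    then show ?case by (auto intro: exI[of _ 0])
  next
    case (Suc n)
    then obtain E where E: "alt_sum c n = (if odd n then c (Suc k) else 0) + (c k - c (Suc k)) * E" ..
    from two_valued[OF assms, of n] show ?case
    proof
      assume "c n = c k"
      then show ?thesis using E by (intro exI[of _ "E + (-1) ^ n"]) (auto simp: algebra_simps)
    next
      assume "c n = c (Suc k)"
      then show ?thesis using E by (intro exI[of _ E]) (auto simp: algebra_simps)
    qed
  qed
  then show ?thesis using that by blast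
qed

text \<open>
  After an odd number of twists the sequence returns reflected. If only four colors occur, it takes
  two values \<open>u\<close> and \<open>v\<close>, so the reflection at \<open>s\<^sub>a\<close> exchanges
  them and \<open>2 s\<^sub>a = u + v\<close>. But \<open>s\<^sub>a\<close> is congruent to \<open>v\<close> modulo \<open>u - v\<close>.
\<close>

lemma card_colors_ge_5_odd_twists:
  assumes "odd a" and fixed: "\<And>i. transport c a (c (a + i)) = c i"
  shows "5 \<le> card (colors c)"
proof (rule ccontr)
  assume "\<not> 5 \<le> card (colors c)"
  then have less: "card (colors c) < 5" by simp
  have sum: "c i + c (a + i) = 2 * alt_sum c a" for i
    using fixed[of i] \<open>odd a\<close> by (simp add: transport_def)
  have "2 * alt_sum c a = c k + c (Suc k)"
    using sum[of k] sum[of "Suc k"] two_valued[OF less, of "a + k"] two_valued[OF less, of "a + Suc k"] neq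
    by auto
  moreover obtain E where "alt_sum c a = c (Suc k) + (c k - c (Suc k)) * E"
    using alt_sum_mod[OF less, of a] \<open>odd a\<close> by auto
  ultimately have "(c k - c (Suc k)) * (2 * E - 1) = 0" by (simp add: algebra_simps)
  then have "2 * E = 1" using neq by simp
  then show False by presburger
qed

text \<open>
  For odd period \<open>b\<close>, \<open>g\<^sub>k\<^sub>+\<^sub>b(y) = 2 s\<^sub>b - g\<^sub>k(y)\<close>, so the set of colors is symmetric about \<open>s\<^sub>b\<close>. If it
  were the four-term progression, then \<open>2 s\<^sub>b = 2 x + 3 d\<close>. But \<open>2 s\<^sub>b\<close> and \<open>2 x\<close> are
  both congruent to \<open>2 c\<^sub>k\<^sub>+\<^sub>1\<close> modulo \<open>2 d\<close>, which would make \<open>3 d\<close> a multiple of \<open>2 d\<close>.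
\<close>

lemma card_colors_ge_5_odd_strands:
  assumes "odd b" and period: "\<And>i. c (i + b) = c i"
  shows "5 \<le> card (colors c)"
proof (rule ccontr)
  assume "\<not> 5 \<le> card (colors c)"
  then have less: "card (colors c) < 5" by simp
  have "c (b + n) = c n" for n using period[of n] by (simp add: add.commute)
  then have "alt_sum c (b + n) = alt_sum c b - alt_sum c n" for n
    using \<open>odd b\<close> by (induction n) (simp_all add: power_add)
  then have "transport c (b + n) y = 2 * alt_sum c b - transport c n y" for n y
    using \<open>odd b\<close> by (simp add: transport_def power_add)
  then have sym: "2 * alt_sum c b - y \<in> colors c" if "y \<in> colors c" for y
    using that by (auto simp: colors_def) (metis rangeI image_eqI)
  \<comment> \<open>A symmetry of the progression must exchange its two ends.\<close>
  have "2 * alt_sum c b - x \<in> {x, x + d, x + 2 * d, x + 3 * d}"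
    "2 * alt_sum c b - (x + 3 * d) \<in> {x, x + d, x + 2 * d, x + 3 * d}"
    using sym progression unfolding colors_eq_progression[OF less] by blast+
  then have "2 * alt_sum c b = 2 * x + 3 * d"
    using d_nonzero by auto
  moreover obtain E where "alt_sum c b = c (Suc k) + (c k - c (Suc k)) * E"
    using alt_sum_mod[OF less, of b] \<open>odd b\<close> by auto
  moreover obtain F where "alt_sum c k = (if odd k then c (Suc k) else 0) + (c k - c (Suc k)) * F"
    using alt_sum_mod[OF less, of k] by blast
  then have "x = c (Suc k) + 2 * (c k - c (Suc k)) * F"
    by (cases "even k") (simp_all add: transport_def algebra_simps)
  ultimately have "(c k - c (Suc k)) * (2 * E - 4 * F - 3 * (-1) ^ k) = 0"
    by (simp add: algebra_simps)
  then have "2 * E - 4 * F - 3 * (-1) ^ k = 0" using neq by simp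
  then show False by (cases "even k") (simp; presburger)+
qed

end

lemma periodic_gcd:
  assumes m: "\<And>i. c (i + m) = c i" and n: "\<And>i. c (i + n) = c i"
  shows "c (i + gcd m n) = c (i :: nat)"
proof (cases "m = 0")
  case True
  then show ?thesis using n by simp
next
  case False
  have mult: "c (i + l * y) = c i" if "\<And>i. c (i + l) = c i" for l y i
  proof (induction y)
    case (Suc y)
    have "c (i + l * Suc y) = c (i + l * y + l)" by (simp add: algebra_simps)
    with Suc that show ?case by simp
  qed simp
  from bezout_nat[OF False] obtain y z where "m * y = n * z + gcd m n" by blast
  then have "i + m * y = i + gcd m n + n * z" by simp
  then show ?thesis using mult[of m i y, OF m] mult[of n "i + gcd m n" z, OF n] by metis
qed

text \<open>
  For even \<open>a\<close> the sequence returns translated by \<open>2 s\<^sub>a\<close>, and a periodic sequence of integers admits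
  only the translation by zero.
\<close>

lemma even_twists_period:
  assumes "even a" "1 \<le> b" and period: "\<And>i. c (i + b) = c i"
    and fixed: "\<And>i. transport c a (c (a + i)) = c i"
  shows "alt_sum c a = 0" "c (i + a) = c i"
proof -
  have step: "c (i + a) = c i - 2 * alt_sum c a" for i
    using fixed[of i] assms(1) by (simp add: transport_def add.commute)
  have "c (0 + m * a) = c 0 - 2 * int m * alt_sum c a" for m
  proof (induction m)
    case (Suc m)
    have "c (0 + Suc m * a) = c (0 + m * a + a)" by (simp add: algebra_simps)
    with Suc step[of "0 + m * a"] show ?case by (simp add: algebra_simps)
  qed simp
  from this[of b] have "2 * int b * alt_sum c a = 0"
    using periodic_mod[of c b "b * a"] periodic_mod[of c b 0] period by simp
  then show "alt_sum c a = 0" using assms(2) by simp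
  with step show "c (i + a) = c i" by simp
qed

text \<open>
  Going around twice gives the period \<open>2 a\<close>. As \<open>b\<close> is odd, the greatest common divisor of \<open>2 a\<close>
  and \<open>b\<close> divides \<open>a\<close>, so \<open>a\<close> itself is a period, while \<open>c\<^sub>i + c\<^sub>i\<^sub>+\<^sub>a = 2 s\<^sub>a\<close>.
\<close>

lemma constant_odd_odd:
  assumes "odd a" "odd b" and period: "\<And>i. c (i + b) = c i"
    and fixed: "\<And>i. transport c a (c (a + i)) = c i"
  shows "c (Suc i) = c i"
proof -
  have sum: "c i + c (i + a) = 2 * alt_sum c a" for i
    using fixed[of i] \<open>odd a\<close> by (simp add: transport_def add.commute)
  have "c (i + 2 * a) = c i" for i
  proof -
    have "i + 2 * a = i + a + a" by simp
    moreover have "c (i + a + a) = c i" using sum[of i] sum[of "i + a"] by linarith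
    ultimately show ?thesis by metis
  qed
  then have g: "c (i + gcd (2 * a) b) = c i" for i using periodic_gcd[of c "2 * a" b] period by blast
  have "gcd (2 * a) b = gcd a b"
    by (rule gcd_mult_left_left_cancel) (use \<open>odd b\<close> in simp)
  with g have g: "c (i + gcd a b) = c i" for i by simp
  have "c (i + a) = c i" for i
  proof -
    have "(i + a) mod gcd a b = i mod gcd a b" using mod_add_right_eq[of i a "gcd a b"] by simp
    then show ?thesis
      using periodic_mod[of c "gcd a b" "i + a", OF g] periodic_mod[of c "gcd a b" i, OF g] by simp
  qed
  then have "c i = alt_sum c a" for i using sum[of i] by simp
  then show ?thesis by simp
qed

text \<open>
  The sequence has period 2, and its alternating sum of even length \<open>a\<close>, which vanishes, is a
  multiple of \<open>c\<^sub>0 - c\<^sub>1\<close>. This covers the links \<open>T(2p, 2q)\<close> with coprime \<open>p\<close> and \<open>q\<close>, which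
  have even parameters but no nontrivial coloring.
\<close>

lemma constant_gcd_2:
  assumes "gcd a b = 2" "1 \<le> a" "1 \<le> b" and period: "\<And>i. c (i + b) = c i"
    and fixed: "\<And>i. transport c a (c (a + i)) = c i"
  shows "c (Suc i) = c i"
proof -
  have even: "even a" using assms(1) by (metis gcd_dvd1)
  note a = even_twists_period[OF even assms(3) period fixed]
  have two: "c (i + 2) = c i" for i
    using periodic_gcd[of c a b] a(2) period assms(1) by metis
  obtain m where m: "a = 2 * m" using even by blast
  have "alt_sum c (2 * m) = int m * (c 0 - c 1)" for m
  proof (induction m)
    case (Suc m)
    have "c (2 * m) = c 0" "c (Suc (2 * m)) = c 1"
      using periodic_mod[of c 2 "2 * m"] periodic_mod[of c 2 "Suc (2 * m)"] two by simp_all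
    with Suc show ?case by (simp add: algebra_simps)
  qed simp
  with a(1) m assms(2) have "c 0 = c 1" by simp
  moreover have "c i = (if even i then c 0 else c 1)" for i
  proof -
    have "c (i mod 2) = c i" by (rule periodic_mod) (rule two)
    then show ?thesis by (auto simp: mod_2_eq_odd)
  qed
  ultimately show ?thesis by metis
qed

text \<open>
  The two ones cancel in the alternating sums; these are therefore \<open>0\<close>, or \<open>-1\<close> between the two ones.
\<close>

lemma four_colors_even:
  assumes "even r" "4 \<le> r"
  defines "c \<equiv> \<lambda>i. if i mod r \<in> {1, 2} then 1 else 0 :: int"
  shows "c (i + r * m) = c i" "transport c (r * m) (c (r * m + i)) = c i" "colors c \<subseteq> {-2, -1, 0, 1}"
    "c 1 \<noteq> c 0"
proof -
  have sum: "alt_sum c k = (if k mod r = 2 then -1 else 0)" for k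
  proof (induction k)
    case (Suc k)
    have "even (k mod r) = even k" using assms(1) by (simp add: dvd_mod_iff)
    moreover have "(-1 :: int) ^ k = (if even k then 1 else -1)" by simp
    ultimately show ?case using Suc assms(2) by (auto simp: c_def mod_Suc)
  qed (use assms in auto)
  show "c (i + r * m) = c i" by (simp add: c_def)
  show "transport c (r * m) (c (r * m + i)) = c i"
    using assms(1) by (simp add: transport_def sum) (simp add: c_def)
  show "colors c \<subseteq> {-2, -1, 0, 1}"
  proof -
    have "transport c k (c j) \<in> {-2, -1, 0, 1}" for k j
    proof -
      have "even (k mod r) = even k" using assms(1) by (simp add: dvd_mod_iff)
      moreover have "c j = 0 \<or> c j = 1" by (simp add: c_def)
      ultimately show ?thesis by (cases "even k") (auto simp: transport_def sum)
    qed
    then show ?thesis by (auto simp: colors_def)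
  qed
  show "c 1 \<noteq> c 0" using assms(2) by (simp add: c_def)
qed

text \<open>
  One period, of odd length, has alternating sum \<open>1\<close>, and the next one contributes \<open>-1\<close>. Hence the
  alternating sums are \<open>0\<close> and \<open>1\<close> in alternate periods.
\<close>

lemma five_colors_even_twists:
  assumes "odd r" "3 \<le> r"
  defines "c \<equiv> \<lambda>i. if r dvd Suc i then 1 else 0 :: int"
  shows "c (i + r * m) = c i" "even m \<Longrightarrow> transport c (r * m) (c (r * m + i)) = c i" "colors c \<subseteq> {-1, 0, 1, 2, 3}"
    "c (r - 1) \<noteq> c (r - 2)"
proof -
  have sum: "alt_sum c k = (if even (k div r) then 0 else 1)" for k
  proof (induction k)
    case (Suc k)
    show ?case
    proof (cases "r dvd Suc k")
      case True
      then obtain m where m: "Suc k = r * m" by blast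
      then have "Suc k div r = m" using assms(2) by simp
      moreover have "Suc k div r = Suc (k div r)" using True by (simp add: div_Suc dvd_eq_mod_eq_0)
      moreover have "even (Suc k) = even m" using m assms(1) by simp
      ultimately show ?thesis using Suc True by (auto simp: c_def)
    next
      case False
      then have "Suc k div r = k div r" by (simp add: div_Suc dvd_eq_mod_eq_0)
      then show ?thesis using Suc False by (simp add: c_def)
    qed
  qed simp
  show per: "c (i + r * m) = c i" for i
    using dvd_add_left_iff[of r "r * m" "Suc i"] by (simp add: c_def)
  show "transport c (r * m) (c (r * m + i)) = c i" if "even m"
    using assms(2) that per[of i] by (simp add: transport_def sum add.commute)
  show "colors c \<subseteq> {-1, 0, 1, 2, 3}"
  proof -
    have "c j = 0 \<or> c j = 1" for j by (simp add: c_def)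
    then have "transport c k (c j) \<in> {-1, 0, 1, 2, 3}" for k j
      by (cases "even k") (auto simp: transport_def sum)
    then show ?thesis by (auto simp: colors_def)
  qed
  show "c (r - 1) \<noteq> c (r - 2)"
  proof -
    have "Suc (r - 1) = r" "Suc (r - 2) = r - 1" using assms(2) by auto
    moreover have "\<not> r dvd r - 1" using assms(2) by (auto dest: dvd_imp_le)
    ultimately show ?thesis by (simp add: c_def)
  qed
qed

text \<open>
  The second half of the period \<open>2 r\<close> is the reflection at \<open>1\<close> of the first half, which has
  alternating sum \<open>1\<close>. In the second half the alternating sums oscillate between \<open>1\<close> and \<open>-1\<close>.
\<close>

lemma five_colors_even_strands:
  assumes "odd r" "3 \<le> r"
  defines "c \<equiv> \<lambda>i. if r dvd Suc i then 1 else if even (i div r) then 0 else 2 :: int"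
  shows "even m \<Longrightarrow> c (i + r * m) = c i" "odd m \<Longrightarrow> transport c (r * m) (c (r * m + i)) = c i"
    "colors c \<subseteq> {-2, -1, 0, 1, 2}" "c (r - 1) \<noteq> c (r - 2)"
proof -
  have sum: "alt_sum c k = (if even (k div r) then 0 else if even k then -1 else 1)" for k
  proof (induction k)
    case (Suc k)
    show ?case
    proof (cases "r dvd Suc k")
      case True
      then obtain m where m: "Suc k = r * m" by blast
      then have "Suc k div r = m" using assms(2) by simp
      moreover have "Suc k div r = Suc (k div r)" using True by (simp add: div_Suc dvd_eq_mod_eq_0)
      moreover have "even (Suc k) = even m" using m assms(1) by simp
      ultimately show ?thesis using Suc True by (auto simp: c_def)
    next
      case False
      then have "Suc k div r = k div r" by (simp add: div_Suc dvd_eq_mod_eq_0)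
      then show ?thesis using Suc False by (auto simp: c_def)
    qed
  qed simp
  have dvd: "r dvd Suc (i + r * m) \<longleftrightarrow> r dvd Suc i" for i m
    using dvd_add_left_iff[of r "r * m" "Suc i"] by simp
  have div: "(i + r * m) div r = i div r + m" for i m using assms(2) by simp
  show "c (i + r * m) = c i" if "even m" using that by (simp add: c_def dvd div)
  show "transport c (r * m) (c (r * m + i)) = c i" if "odd m"
  proof -
    have "alt_sum c (r * m) = 1" using that assms(1,2) by (simp add: sum)
    moreover have "c (r * m + i) = 2 - c i"
      using that dvd[of i m] div[of i m] by (simp add: c_def add.commute)
    ultimately show ?thesis using that assms(1) by (simp add: transport_def)
  qed
  show "colors c \<subseteq> {-2, -1, 0, 1, 2}"
  proof -
    have "c j = 0 \<or> c j = 1 \<or> c j = 2" for j by (simp add: c_def)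
    then have "transport c k (c j) \<in> {-2, -1, 0, 1, 2}" for k j
      by (cases "even k") (auto simp: transport_def sum)
    then show ?thesis by (auto simp: colors_def)
  qed
  show "c (r - 1) \<noteq> c (r - 2)"
  proof -
    have "Suc (r - 1) = r" "Suc (r - 2) = r - 1" using assms(2) by auto
    moreover have "\<not> r dvd r - 1" using assms(2) by (auto dest: dvd_imp_le)
    ultimately show ?thesis by (simp add: c_def)
  qed
qed

section \<open>Torus links\<close>

definition braid_coloring :: "nat \<Rightarrow> nat \<Rightarrow> (nat \<Rightarrow> int) \<Rightarrow> bool" where
  "braid_coloring a b c \<longleftrightarrow> (\<forall>i. c (i + b) = c i) \<and> (\<forall>i. transport c a (c (a + i)) = c i)"

lemma run_standard_diagram_colors:
  assumes "1 \<le> b" "a \<noteq> 0"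
  shows "run (standard_diagram a b) [] K [] \<longleftrightarrow> (\<exists>c. braid_coloring (nat \<bar>a\<bar>) b c \<and> K = colors c)"
  unfolding run_standard_diagram_periodic[OF assms] braid_coloring_def colors_def by simp

lemma link_diagram_standard:
  assumes "1 \<le> b" "a \<noteq> 0"
  shows "link_diagram (standard_diagram a b)"
proof -
  have "braid_coloring (nat \<bar>a\<bar>) b (\<lambda>_. 0)"
    by (simp add: braid_coloring_def transport_def alt_sum_def)
  then have "run (standard_diagram a b) [] (colors (\<lambda>_. 0)) []"
    unfolding run_standard_diagram_colors[OF assms] by blast
  then show ?thesis by (rule run_link_diagram)
qed

lemma Z_colorable_torus_link:
  assumes "1 \<le> b" "a \<noteq> 0"
  shows "Z_colorable (torus_link a b) \<longleftrightarrow> (\<exists>c k. braid_coloring (nat \<bar>a\<bar>) b c \<and> c k \<noteq> c (Suc k))"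
proof -
  have "Z_colorable (torus_link a b) \<longleftrightarrow>
      (\<exists>c. braid_coloring (nat \<bar>a\<bar>) b c \<and> (\<nexists>z. colors c \<subseteq> {z}))"
    unfolding torus_link_def Z_colorable_link_of[OF link_diagram_standard[OF assms]]
      colorable_diagram_def run_standard_diagram_colors[OF assms] by blast
  then show ?thesis unfolding colors_trivial_iff by blast
qed

lemma mincol_Z_standard_diagram:
  assumes "1 \<le> b" "a \<noteq> 0"
    and "braid_coloring (nat \<bar>a\<bar>) b c" "c k \<noteq> c (Suc k)" "card (colors c) \<le> n"
    and lower: "\<And>c k. braid_coloring (nat \<bar>a\<bar>) b c \<Longrightarrow> color_step c k \<Longrightarrow> n \<le> card (colors c)"
  shows "mincol_Z (standard_diagram a b) = n"
  unfolding mincol_Z_def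
proof (rule Least_equality)
  let ?D = "standard_diagram a b"
  have finite: "finite (colors c)" if "braid_coloring (nat \<bar>a\<bar>) b c" for c
    using that run_finite[of ?D "[]" "colors c" "[]"] run_standard_diagram_colors[OF assms(1,2), of "colors c"] by blast
  have iff: "(\<exists>\<gamma>. nontrivial_Z_coloring ?D \<gamma> \<and> \<gamma> ` arcs ?D = K) \<longleftrightarrow>
      (\<exists>c k. braid_coloring (nat \<bar>a\<bar>) b c \<and> color_step c k \<and> K = colors c)" for K
  proof -
    have "(\<exists>\<gamma>. nontrivial_Z_coloring ?D \<gamma> \<and> \<gamma> ` arcs ?D = K) \<longleftrightarrow>
        (\<exists>c. braid_coloring (nat \<bar>a\<bar>) b c \<and> K = colors c \<and> (\<nexists>z. colors c \<subseteq> {z}))"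
      unfolding nontrivial_Z_coloring_run[OF link_diagram_standard[OF assms(1,2)]]
        run_standard_diagram_colors[OF assms(1,2)] by blast
    also have "\<dots> \<longleftrightarrow> (\<exists>c k. braid_coloring (nat \<bar>a\<bar>) b c \<and> color_step c k \<and> K = colors c)"
      unfolding colors_trivial_iff color_step_def using finite by blast
    finally show ?thesis .
  qed
  have step: "color_step c k" using assms(3,4) finite by (simp add: color_step_def)
  then have n: "n = card (colors c)" using lower[OF assms(3)] assms(5) by (simp add: le_antisym)
  have "\<exists>\<gamma>. nontrivial_Z_coloring ?D \<gamma> \<and> \<gamma> ` arcs ?D = colors c"
    unfolding iff using assms(3) step by blast
  then show "\<exists>\<gamma>. nontrivial_Z_coloring ?D \<gamma> \<and> card (\<gamma> ` arcs ?D) = n"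
    unfolding n by metis
  fix m assume "\<exists>\<gamma>. nontrivial_Z_coloring ?D \<gamma> \<and> card (\<gamma> ` arcs ?D) = m"
  then obtain \<gamma> where \<gamma>: "nontrivial_Z_coloring ?D \<gamma>" "card (\<gamma> ` arcs ?D) = m" by blast
  then obtain c' k' where "braid_coloring (nat \<bar>a\<bar>) b c'" "color_step c' k'" "\<gamma> ` arcs ?D = colors c'"
    using iff[of "\<gamma> ` arcs ?D"] by blast
  with lower[of c' k'] \<gamma>(2) show "n \<le> m" by simp
qed

lemma braid_coloring_few_colors:
  assumes "2 < r" "even (m * r) \<or> even (n * r)" "coprime m n"
  shows "\<exists>c k. braid_coloring (m * r) (n * r) c \<and> c k \<noteq> c (Suc k) \<and>
    card (colors c) \<le> (if even r then 4 else 5)"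
proof -
  have few: ?thesis
    if "\<And>i. c (i + r * n) = c i" "\<And>i. transport c (r * m) (c (r * m + i)) = c i"
      "colors c \<subseteq> set xs" "c k \<noteq> c (Suc k)" "length xs = (if even r then 4 else 5)" for c xs k
  proof -
    have "card (colors c) \<le> length xs"
      using card_mono[OF _ that(3)] card_length[of xs] by simp
    with that show ?thesis
      by (intro exI[of _ c] exI[of _ k]) (simp add: braid_coloring_def mult.commute)
  qed
  consider "even r" | "odd r" "even m" | "odd r" "even n" "odd m"
    using assms by auto
  then show ?thesis
  proof cases
    case 1
    then have r: "4 \<le> r" using assms(1) by (cases "r = 3") auto
    note c = four_colors_even[OF 1 r]
    show ?thesis
      by (intro few[OF c(1,2), of "[-2, -1, 0, 1]" 0]) (use c(3,4) 1 in auto)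
  next
    case 2
    have r: "3 \<le> r" using assms(1) by simp
    note c = five_colors_even_twists[OF 2(1) r]
    have "Suc (r - 2) = r - 1" using r by simp
    then show ?thesis
      by (intro few[OF c(1) c(2)[OF 2(2)], of "[-1, 0, 1, 2, 3]" "r - 2"]) (use c(3,4) 2 in auto)
  next
    case 3
    have r: "3 \<le> r" using assms(1) by simp
    note c = five_colors_even_strands[OF 3(1) r]
    have "Suc (r - 2) = r - 1" using r by simp
    then show ?thesis
      by (intro few[OF c(1)[OF 3(2)] c(2)[OF 3(3)], of "[-2, -1, 0, 1, 2]" "r - 2"]) (use c(3,4) 3 in auto)
  qed
qed

theorem theorem1p1:
  fixes p q r :: int
  assumes "p \<noteq> 0" "q \<noteq> 0" "r \<noteq> 0"
    and "coprime p q"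
    and "\<bar>p\<bar> \<ge> q" "q \<ge> 1"
    and "r \<ge> 2"
  shows "(r \<ge> 3 \<longrightarrow>
           (Z_colorable (torus_link (p * r) (nat (q * r))) \<longleftrightarrow> even (p * r) \<or> even (q * r))) \<and>
         (Z_colorable (torus_link (p * r) (nat (q * r))) \<longrightarrow>
           mincol_Z (standard_diagram (p * r) (nat (q * r))) = (if even r then 4 else 5))"
proof -
  define m n s where "m = nat \<bar>p\<bar>" and "n = nat q" and "s = nat r"
  have s: "r = int s" "2 \<le> s" and n: "q = int n" "1 \<le> n" and m: "\<bar>p\<bar> = int m" "1 \<le> m"
    using assms by (auto simp: m_def n_def s_def)
  have a: "nat \<bar>p * r\<bar> = m * s" "p * r \<noteq> 0"
    using assms s m by (simp_all add: abs_mult flip: of_nat_mult)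
  have b: "nat (q * r) = n * s" "1 \<le> nat (q * r)"
    using n s by (simp_all flip: of_nat_mult)
  have even_p: "even p = even m" using m(1) by (metis dvd_abs_iff even_of_nat)
  have coprime: "coprime m n"
    using assms(4) m(1) n(1) by (metis coprime_abs_left_iff coprime_int_iff)
  have parity: "even (p * r) \<or> even (q * r) \<longleftrightarrow> even (m * s) \<or> even (n * s)"
    using n(1) s(1) even_p by simp
  have colorable: "Z_colorable (torus_link (p * r) (nat (q * r))) \<longleftrightarrow>
      (\<exists>c k. braid_coloring (m * s) (n * s) c \<and> c k \<noteq> c (Suc k))"
    using Z_colorable_torus_link[OF b(2) a(2)] unfolding a b .
  have even: "even (m * s) \<or> even (n * s)" if "braid_coloring (m * s) (n * s) c" "c k \<noteq> c (Suc k)" for c k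
    using constant_odd_odd[of "m * s" "n * s" c k] that unfolding braid_coloring_def by metis
  have not_2: "s \<noteq> 2" if "braid_coloring (m * s) (n * s) c" "c k \<noteq> c (Suc k)" for c k
  proof
    assume "s = 2"
    then have "gcd (m * s) (n * s) = 2" using coprime by (simp add: gcd_mult_right gcd.commute[of n])
    moreover have "1 \<le> m * s" "1 \<le> n * s" using m(2) n(2) s(2) by simp_all
    ultimately have "c (Suc k) = c k"
      using that(1) unfolding braid_coloring_def by (intro constant_gcd_2) blast+
    with that(2) show False by simp
  qed
  have "mincol_Z (standard_diagram (p * r) (nat (q * r))) = (if even r then 4 else 5)"
    if "Z_colorable (torus_link (p * r) (nat (q * r)))"
  proof -
    from that colorable obtain c0 k0 where c0: "braid_coloring (m * s) (n * s) c0" "c0 k0 \<noteq> c0 (Suc k0)"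
      by blast
    from not_2[OF c0] s have "2 < s" by simp
    from braid_coloring_few_colors[OF this even[OF c0] coprime] obtain c k
      where c: "braid_coloring (m * s) (n * s) c" "c k \<noteq> c (Suc k)"
        "card (colors c) \<le> (if even s then 4 else 5)" by blast
    have lower: "(if even s then 4 else 5) \<le> card (colors c)"
      if "braid_coloring (m * s) (n * s) c" "color_step c k" for c k
    proof (cases "even s")
      case True
      then show ?thesis using color_step.card_colors_ge_4[OF that(2)] by simp
    next
      case False
      have "odd m \<or> odd n" using coprime by (auto dest: coprime_common_divisor)
      then show ?thesis
        using that(1) False color_step.card_colors_ge_5_odd_twists[OF that(2), of "m * s"]
          color_step.card_colors_ge_5_odd_strands[OF that(2), of "n * s"]
        unfolding braid_coloring_def by auto
    qed
    have "mincol_Z (standard_diagram (p * r) (nat (q * r))) = (if even s then 4 else 5)"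
      unfolding b(1) by (rule mincol_Z_standard_diagram[OF b(2) a(2), unfolded a(1) b(1), OF c lower])
    then show ?thesis using s(1) by simp
  qed
  moreover have "Z_colorable (torus_link (p * r) (nat (q * r))) \<longleftrightarrow> even (p * r) \<or> even (q * r)"
    if "r \<ge> 3"
  proof -
    have "2 < s" using that s by simp
    then show ?thesis
      unfolding colorable parity using even braid_coloring_few_colors[OF \<open>2 < s\<close> _ coprime] by blast
  qed
  ultimately show ?thesis by blast
qed

end
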